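(* Let $K$ be a primitive triangulation of a smooth $2$-dimensional lattice polytope $P$ (so $n=1$) and let $\tilde\rho\in H^1(X;\mathcal W_1)$ be the canonical integrable wave defined in the context. The solutions $\varepsilon\in C^0(K;\mathbb F_2)$ of the equation $$\nabla^2\varepsilon=\tilde\rho$$ are the restrictions of quadratic polynomial functions $M_2\to\mathbb F_2$ to the vertices of $K$. As such, every $2$-dimensional primitive triangulation is simply integrable.
   Context: Polytope and triangulation. $M,N$ are dual lattices of rank $2$ with pairing $\langle-,-\rangle$; $M_2=M\otimes\mathbb F_2$, $N_2=N\otimes\mathbb F_2$. A full-dimensional lattice polygon $P\subset M\otimes\mathbb R$ is smooth if at each vertex the primitive edge directions form a basis of $M$. A primitive triangulation $K$ of $P$ is a triangulation into lattice triangles of area $1/2$ (unit area = parallelogram on a basis of $M$); its vertices are exactly $P\cap M$. A simplex is interior if it is not contained in $\partial P$. A function on $M_2$ is restricted to the vertices of $K$ by reduction modulo $2$. A quadratic polynomial function $M_2\to\mathbb F_2$ is a function of degree exactly two, i.e. in linear coordinates $(x,y)$ of the form $xy$ plus an affine function. Complexes. For $\sigma\le\tau$ in $K$, $[\sigma,\tau]$ is the union of the simplices of the barycentric subdivision given by flags between $\sigma$ and $\tau$; for $\sigma$ contained in a face $Q$ of $P$, $[\sigma,Q]=\bigcup_{\sigma\le\tau\subset Q}[\sigma,\tau]$ is a ball of dimension $\dim Q-\dim\sigma$. These are the closed cells of a regular CW structure $Y$ on $P$, with $[\sigma',Q']\le[\sigma,Q]$ iff $\sigma'\ge\sigma$,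 $Q'\subset Q$. $X\le Y$ is the subcomplex (a graph) of cells with $\dim\sigma\ge1$. Put $\sigma^*=[\sigma,P]$ and $X_0=X\cap\bigcup_{v\text{ interior vertex}}v^*$. Waves and Hessian. A cellular sheaf $\mathcal G$ has functorial maps $\mathcal G(e')\to\mathcal G(e)$ for $e'\le e$; $H^q(-;\mathcal G)$ is its cellular cohomology. $\mathcal W_1$ is the sheaf on $X$ with $\mathcal W_1(\sigma,Q)=((T\sigma)^\perp\cap N)\otimes\mathbb F_2\subset N_2$ ($T\sigma$ the linear tangent space) and inclusions as transition maps. $\mathcal Z^1$ is the sheaf $[\sigma,Q]\mapsto Z^1(\sigma;\mathbb F_2)$ (simplicial 1-cocycles, restrictions). There is a short exact sequence $0\to\mathcal W_1\to N_2\xrightarrow{z}\mathcal Z^1|_X\to0$ with $N_2$ constant and $z(u)(\sigma^1)=\langle v_0-v_1,u\rangle$ for an edge $\sigma^1$ with endpoints $v_0,v_1$. For $\varepsilon\in C^0(K;\mathbb F_2)$, $\nabla^2\varepsilon\in H^1(X;\mathcal W_1)$ is the image under the connecting morphism $H^0(X;\mathcal Z^1)\to H^1(X;\mathcal W_1)$ of the section $[\sigma,Q]\mapsto\mathrm d\varepsilon|_\sigma$. A wave in $H^1(X;\mathcal W_1)$ is integrable if its image in $H^1(X;N_2)$ vanishes. The wave $\tilde\rho$. For an interior edge $\sigma^1$ of $K$ let $v_1,v_2$ be the vertices opposite to $\sigma^1$ in its two adjacent triangles; there are unique $\rho_{\sigma^1}(v)\in\mathbb F_2$, $v$ a vertex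 of $\sigma^1$, with $\sum_{v\in\sigma^1}\rho_{\sigma^1}(v)=0$ and $\sum_{v\in\sigma^1}\rho_{\sigma^1}(v)v=v_1-v_2$ in $M_2$; hence $\rho_{\sigma^1}$ takes the same value on both vertices of $\sigma^1$. $\tilde\rho$ is the class of the 1-cochain whose value on $(\sigma^1)^*$ is $\rho_{\sigma^1}(v)$ times the generator of the line $\mathcal W_1((\sigma^1)^* )$ if $\sigma^1$ is interior ($v$ any vertex of $\sigma^1$), and $0$ if $\sigma^1\subset\partial P$. It satisfies $\tilde\rho|_{\partial v^*}=\nabla^2\chi_v|_{\partial v^*}$ for every interior vertex $v$, where $\chi_v$ is $1$ on $v$ and $0$ elsewhere. $K$ is $\rho$-uniform if there is a (necessarily unique) $\rho\in H^1(X_0;\mathcal W_1)$ with $\rho|_{\partial v^*}=\nabla^2\chi_v|_{\partial v^*}$ for every interior vertex $v$, and simply integrable if it is $\rho$-uniform and there is $\varepsilon\in C^0(K;\mathbb F_2)$ with $\nabla^2\varepsilon|_{X_0}=\rho$. *)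

theory Defs
  imports "HOL-Analysis.Analysis" "HOL-Library.Z2" "HOL-Library.Function_Algebras"
begin

section \<open>Lattices of rank two\<close>

text \<open>
  After a choice of dual bases, \<open>M\<close> and \<open>N\<close> are both the integer lattice in \<^typ>\<open>real ^ 2\<close>,
  paired by the inner product, and \<open>M \<otimes> F\<^sub>2\<close> and \<open>N \<otimes> F\<^sub>2\<close> are both \<^typ>\<open>bit ^ 2\<close>,
  paired by \<open>pair2\<close>.
\<close>

definition lattice :: "(real ^ 2) set" where
  "lattice = {x. \<forall>i. x $ i \<in> \<int>}"

text \<open>Only meaningful on lattice points, where the floor just recovers the integer coordinate.\<close>

definition red2 :: "real ^ 2 \<Rightarrow> bit ^ 2" where
  "red2 x = (\<chi> i. of_int \<lfloor>x $ i\<rfloor>)"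

definition pair2 :: "bit ^ 2 \<Rightarrow> bit ^ 2 \<Rightarrow> bit" where
  "pair2 x u = (\<Sum>i\<in>UNIV. x $ i * u $ i)"

definition lattice_basis :: "(real ^ 2) set \<Rightarrow> bool" where
  "lattice_basis B \<longleftrightarrow>
     independent B \<and> range (\<lambda>c :: real ^ 2 \<Rightarrow> int. \<Sum>b\<in>B. of_int (c b) *\<^sub>R b) = lattice"

definition primitive_vec :: "real ^ 2 \<Rightarrow> bool" where
  "primitive_vec u \<longleftrightarrow>
     u \<in> lattice \<and> (\<forall>m :: nat. \<forall>w\<in>lattice. u = real m *\<^sub>R w \<longrightarrow> m = 1)"

definition quadratic_function :: "(bit ^ 2 \<Rightarrow> bit) \<Rightarrow> bool" where
  "quadratic_function q \<longleftrightarrow>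
     (\<exists>a b c. \<forall>p. q p = p $ 1 * p $ 2 + (a * p $ 1 + b * p $ 2 + c))"


section \<open>Smooth polygons and primitive triangulations\<close>

definition edge_directions :: "(real ^ 2) set \<Rightarrow> real ^ 2 \<Rightarrow> (real ^ 2) set" where
  "edge_directions P v =
     {u. primitive_vec u \<and> (\<exists>t>0. closed_segment v (v + t *\<^sub>R u) face_of P)}"

definition smooth_lattice_polygon :: "(real ^ 2) set \<Rightarrow> bool" where
  "smooth_lattice_polygon P \<longleftrightarrow>
     polytope P \<and> aff_dim P = 2 \<and>
     (\<forall>v. v extreme_point_of P \<longrightarrow> v \<in> lattice \<and> lattice_basis (edge_directions P v))"

definition verts :: "(real ^ 2) set \<Rightarrow> (real ^ 2) set" where
  "verts \<sigma> = {v. v extreme_point_of \<sigma>}"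

text \<open>
  Simplices are geometric (closed convex subsets of the plane). The library's notion of a
  simplicial complex contains the empty simplex, of affine dimension \<open>-1\<close>.
\<close>

definition primitive_triangulation :: "(real ^ 2) set set \<Rightarrow> (real ^ 2) set \<Rightarrow> bool" where
  "primitive_triangulation K P \<longleftrightarrow>
     simplicial_complex K \<and> \<Union>K = P \<and>
     (\<forall>\<sigma>\<in>K. verts \<sigma> \<subseteq> lattice) \<and>
     (\<forall>\<sigma>\<in>K. \<exists>\<tau>\<in>K. \<sigma> \<subseteq> \<tau> \<and> aff_dim \<tau> = 2) \<and>
     (\<forall>\<tau>\<in>K. aff_dim \<tau> = 2 \<longrightarrow> measure lborel \<tau> = 1 / 2)"

definition interior_simplex :: "(real ^ 2) set \<Rightarrow> (real ^ 2) set \<Rightarrow> bool" where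
  "interior_simplex P \<sigma> \<longleftrightarrow> \<not> \<sigma> \<subseteq> frontier P"

definition interior_vertex :: "(real ^ 2) set set \<Rightarrow> (real ^ 2) set \<Rightarrow> real ^ 2 \<Rightarrow> bool" where
  "interior_vertex K P v \<longleftrightarrow> {v} \<in> K \<and> interior_simplex P {v}"

text \<open>0-cochains of \<open>K\<close>: functions on the vertices of \<open>K\<close>, extended by zero.\<close>

definition C0 :: "(real ^ 2) set set \<Rightarrow> (real ^ 2 \<Rightarrow> bit) set" where
  "C0 K = {\<epsilon>. \<forall>v. {v} \<notin> K \<longrightarrow> \<epsilon> v = 0}"

definition restrict_to_vertices ::
    "(real ^ 2) set set \<Rightarrow> (bit ^ 2 \<Rightarrow> bit) \<Rightarrow> real ^ 2 \<Rightarrow> bit" where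
  "restrict_to_vertices K q = (\<lambda>v. if {v} \<in> K then q (red2 v) else 0)"

definition chi :: "real ^ 2 \<Rightarrow> real ^ 2 \<Rightarrow> bit" where
  "chi v = (\<lambda>x. if x = v then 1 else 0)"


section \<open>The regular CW structure\<close>

text \<open>
  The closed cell \<open>[\<sigma>,Q]\<close> is encoded by the pair \<open>(\<sigma>, Q)\<close>. Cellular cohomology depends on the
  regular CW structure only through dimensions and the inclusion relation between closed cells.
  The constraint \<open>\<sigma> \<noteq> {}\<close> removes the empty simplex.
\<close>

type_synonym cell = "(real ^ 2) set \<times> (real ^ 2) set"

definition cell_le :: "cell \<Rightarrow> cell \<Rightarrow> bool" where
  "cell_le c' c \<longleftrightarrow> fst c \<subseteq> fst c' \<and> snd c' \<subseteq> snd c"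

definition cell_dim :: "cell \<Rightarrow> nat" where
  "cell_dim c = nat (aff_dim (snd c) - aff_dim (fst c))"

definition Ycells :: "(real ^ 2) set set \<Rightarrow> (real ^ 2) set \<Rightarrow> cell set" where
  "Ycells K P = {(\<sigma>, Q). \<sigma> \<in> K \<and> \<sigma> \<noteq> {} \<and> Q face_of P \<and> \<sigma> \<subseteq> Q}"

definition Xcells :: "(real ^ 2) set set \<Rightarrow> (real ^ 2) set \<Rightarrow> cell set" where
  "Xcells K P = {c \<in> Ycells K P. aff_dim (fst c) \<ge> 1}"

definition star_cell :: "(real ^ 2) set \<Rightarrow> (real ^ 2) set \<Rightarrow> cell" where
  "star_cell P \<sigma> = (\<sigma>, P)"

text \<open>
  Subcomplexes are given by their sets of cells: \<open>v\<^sup>*\<close> consists of the cells contained in the closed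
  cell \<open>[v,P]\<close>, and its boundary sphere of the proper ones among them.
\<close>

definition closed_star :: "(real ^ 2) set set \<Rightarrow> (real ^ 2) set \<Rightarrow> real ^ 2 \<Rightarrow> cell set" where
  "closed_star K P v = {c \<in> Ycells K P. cell_le c (star_cell P {v})}"

definition boundary_star :: "(real ^ 2) set set \<Rightarrow> (real ^ 2) set \<Rightarrow> real ^ 2 \<Rightarrow> cell set" where
  "boundary_star K P v = closed_star K P v - {star_cell P {v}}"

definition X0cells :: "(real ^ 2) set set \<Rightarrow> (real ^ 2) set \<Rightarrow> cell set" where
  "X0cells K P = Xcells K P \<inter> (\<Union>v\<in>{v. interior_vertex K P v}. closed_star K P v)"


section \<open>Cellular sheaves and their cohomology\<close>

text \<open>
  A cellular sheaf of \<open>F\<^sub>2\<close>-vector spaces: the stalk at each cell, a subgroup of an ambient group,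
  and the map \<open>res c' c\<close> from the stalk at \<open>c'\<close> to the stalk at \<open>c\<close> for \<open>c' \<le> c\<close>.
  Everything is 2-torsion, so the incidence numbers \<open>\<plusminus>1\<close> in the cellular coboundary act as 1.
\<close>

record 'a sheaf =
  stalk :: "cell \<Rightarrow> 'a set"
  res :: "cell \<Rightarrow> cell \<Rightarrow> 'a \<Rightarrow> 'a"

definition cochains :: "cell set \<Rightarrow> 'a::ab_group_add sheaf \<Rightarrow> nat \<Rightarrow> (cell \<Rightarrow> 'a) set" where
  "cochains X G q =
     {f. (\<forall>c. c \<in> X \<and> cell_dim c = q \<longrightarrow> f c \<in> stalk G c) \<and>
         (\<forall>c. \<not> (c \<in> X \<and> cell_dim c = q) \<longrightarrow> f c = 0)}"

definition coboundary :: "cell set \<Rightarrow> 'a::ab_group_add sheaf \<Rightarrow> (cell \<Rightarrow> 'a) \<Rightarrow> cell \<Rightarrow> 'a" where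
  "coboundary X G f = (\<lambda>c. if c \<in> X
     then \<Sum>c' | c' \<in> X \<and> cell_le c' c \<and> cell_dim c = Suc (cell_dim c'). res G c' c (f c')
     else 0)"

definition cocycles :: "cell set \<Rightarrow> 'a::ab_group_add sheaf \<Rightarrow> nat \<Rightarrow> (cell \<Rightarrow> 'a) set" where
  "cocycles X G q = {f \<in> cochains X G q. coboundary X G f = 0}"

fun coboundaries :: "cell set \<Rightarrow> 'a::ab_group_add sheaf \<Rightarrow> nat \<Rightarrow> (cell \<Rightarrow> 'a) set" where
  "coboundaries X G 0 = {0}"
| "coboundaries X G (Suc q) = coboundary X G ` cochains X G q"

definition cohomologous ::
    "cell set \<Rightarrow> 'a::ab_group_add sheaf \<Rightarrow> nat \<Rightarrow> ((cell \<Rightarrow> 'a) \<times> (cell \<Rightarrow> 'a)) set" where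
  "cohomologous X G q =
     {(f, g). f \<in> cocycles X G q \<and> g \<in> cocycles X G q \<and> f - g \<in> coboundaries X G q}"

definition cohomology :: "cell set \<Rightarrow> 'a::ab_group_add sheaf \<Rightarrow> nat \<Rightarrow> (cell \<Rightarrow> 'a) set set" where
  "cohomology X G q = cocycles X G q // cohomologous X G q"

definition coh_class ::
    "cell set \<Rightarrow> 'a::ab_group_add sheaf \<Rightarrow> nat \<Rightarrow> (cell \<Rightarrow> 'a) \<Rightarrow> (cell \<Rightarrow> 'a) set" where
  "coh_class X G q f = cohomologous X G q `` {f}"

text \<open>The restriction \<open>H\<^sup>q(X;G) \<rightarrow> H\<^sup>q(A;G)\<close> to a subcomplex \<open>A\<close> of \<open>X\<close>.\<close>

definition restrict_coh ::
    "cell set \<Rightarrow> 'a::ab_group_add sheaf \<Rightarrow> nat \<Rightarrow> (cell \<Rightarrow> 'a) set \<Rightarrow> (cell \<Rightarrow> 'a) set" where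
  "restrict_coh A G q h =
     cohomologous A G q `` ((\<lambda>f c. if c \<in> A then f c else 0) ` h)"

text \<open>
  The connecting morphism \<open>H\<^sup>q(X;C) \<rightarrow> H\<^sup>q\<^sup>+\<^sup>1(X;A)\<close> of a short exact sequence
  \<open>0 \<rightarrow> A \<rightarrow> B \<rightarrow> C \<rightarrow> 0\<close> in which \<open>A\<close> is a subsheaf of \<open>B\<close> and \<open>z c\<close> is the map \<open>B \<rightarrow> C\<close> at \<open>c\<close>:
  lift a cocycle with values in \<open>C\<close> to a cochain with values in \<open>B\<close> and take its coboundary.
  The cocycles so obtained, over all representatives and all lifts, form one cohomology class.
\<close>

definition connecting ::
    "cell set \<Rightarrow> 'a::ab_group_add sheaf \<Rightarrow> 'a sheaf \<Rightarrow> (cell \<Rightarrow> 'a \<Rightarrow> 'b) \<Rightarrow> nat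
       \<Rightarrow> (cell \<Rightarrow> 'b) set \<Rightarrow> (cell \<Rightarrow> 'a) set" where
  "connecting X A B z q h =
     {w \<in> cocycles X A (Suc q). \<exists>s\<in>h. \<exists>f\<in>cochains X B q.
        (\<forall>c. c \<in> X \<and> cell_dim c = q \<longrightarrow> z c (f c) = s c) \<and> w = coboundary X B f}"


section \<open>Waves and the Hessian\<close>

definition N2_sheaf :: "(bit ^ 2) sheaf" where
  "N2_sheaf = \<lparr>stalk = (\<lambda>c. UNIV), res = (\<lambda>c' c u. u)\<rparr>"

text \<open>
  The sublattice of \<open>N\<close> orthogonal to the tangent space of \<open>\<sigma>\<close> is saturated, so its reduction
  modulo 2 is the image of its reduction map to \<open>N \<otimes> F\<^sub>2\<close>.
\<close>

definition W1_stalk :: "(real ^ 2) set \<Rightarrow> (bit ^ 2) set" where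
  "W1_stalk \<sigma> = red2 ` {u \<in> lattice. \<forall>x\<in>\<sigma>. \<forall>y\<in>\<sigma>. (x - y) \<bullet> u = 0}"

definition W1 :: "(bit ^ 2) sheaf" where
  "W1 = \<lparr>stalk = (\<lambda>c. W1_stalk (fst c)), res = (\<lambda>c' c u. u)\<rparr>"

definition edges :: "(real ^ 2) set \<Rightarrow> (real ^ 2) set set" where
  "edges \<sigma> = {e. e face_of \<sigma> \<and> aff_dim e = 1}"

text \<open>
  Simplicial 1-cochains of a simplex, extended by zero to all sets; the simplicial coboundary of a
  0-cochain at an edge is the sum (equivalently, the difference) of its values at the endpoints.
\<close>

definition simp_d0 :: "(real ^ 2) set \<Rightarrow> (real ^ 2 \<Rightarrow> bit) \<Rightarrow> (real ^ 2) set \<Rightarrow> bit" where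
  "simp_d0 \<sigma> \<epsilon> = (\<lambda>e. if e \<in> edges \<sigma> then \<Sum>v\<in>verts e. \<epsilon> v else 0)"

definition simp_Z1 :: "(real ^ 2) set \<Rightarrow> ((real ^ 2) set \<Rightarrow> bit) set" where
  "simp_Z1 \<sigma> = {s. (\<forall>e. e \<notin> edges \<sigma> \<longrightarrow> s e = 0) \<and>
                   (\<forall>t. t face_of \<sigma> \<and> aff_dim t = 2 \<longrightarrow> (\<Sum>e\<in>edges t. s e) = 0)}"

definition Z1_sheaf :: "((real ^ 2) set \<Rightarrow> bit) sheaf" where
  "Z1_sheaf = \<lparr>stalk = (\<lambda>c. simp_Z1 (fst c)),
               res = (\<lambda>c' c s e. if e \<in> edges (fst c) then s e else 0)\<rparr>"

definition zmap :: "cell \<Rightarrow> bit ^ 2 \<Rightarrow> (real ^ 2) set \<Rightarrow> bit" where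
  "zmap c u = simp_d0 (fst c) (\<lambda>v. pair2 (red2 v) u)"

text \<open>
  The global section \<open>[\<sigma>,Q] \<mapsto> d\<epsilon>|\<^sub>\<sigma>\<close> of the sheaf of cocycles; as an element of cellular \<open>H\<^sup>0\<close> it
  is recorded by its values at the 0-cells.
\<close>

definition d_section ::
    "cell set \<Rightarrow> (real ^ 2 \<Rightarrow> bit) \<Rightarrow> cell \<Rightarrow> (real ^ 2) set \<Rightarrow> bit" where
  "d_section X \<epsilon> = (\<lambda>c. if c \<in> X \<and> cell_dim c = 0 then simp_d0 (fst c) \<epsilon> else 0)"

definition hessian ::
    "(real ^ 2) set set \<Rightarrow> (real ^ 2) set \<Rightarrow> (real ^ 2 \<Rightarrow> bit) \<Rightarrow> (cell \<Rightarrow> bit ^ 2) set" where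
  "hessian K P \<epsilon> =
     connecting (Xcells K P) W1 N2_sheaf zmap 0
       (coh_class (Xcells K P) Z1_sheaf 0 (d_section (Xcells K P) \<epsilon>))"


section \<open>The canonical wave\<close>

text \<open>
  The function on the endpoints of an interior edge is extended by zero to the plane. The order of
  the two opposite vertices is immaterial modulo 2.
\<close>

definition opposite :: "(real ^ 2) set set \<Rightarrow> (real ^ 2) set \<Rightarrow> (real ^ 2) set" where
  "opposite K e = {v. \<exists>\<tau>\<in>K. aff_dim \<tau> = 2 \<and> e face_of \<tau> \<and> v \<in> verts \<tau> - verts e}"

definition edge_rho :: "(real ^ 2) set set \<Rightarrow> (real ^ 2) set \<Rightarrow> real ^ 2 \<Rightarrow> bit" where
  "edge_rho K e = (THE r. (\<forall>v. v \<notin> verts e \<longrightarrow> r v = 0) \<and>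
     (\<Sum>v\<in>verts e. r v) = 0 \<and>
     (\<exists>v1 v2. v1 \<noteq> v2 \<and> opposite K e = {v1, v2} \<and>
        (\<Sum>v\<in>verts e. r v *s red2 v) = red2 v1 - red2 v2))"

definition W1_generator :: "(real ^ 2) set \<Rightarrow> bit ^ 2" where
  "W1_generator e = (THE g. g \<in> W1_stalk e \<and> g \<noteq> 0)"

definition rho_cochain ::
    "(real ^ 2) set set \<Rightarrow> (real ^ 2) set \<Rightarrow> cell \<Rightarrow> bit ^ 2" where
  "rho_cochain K P = (\<lambda>c.
     if \<exists>e\<in>K. aff_dim e = 1 \<and> interior_simplex P e \<and> c = star_cell P e
     then edge_rho K (fst c) (SOME v. v \<in> verts (fst c)) *s W1_generator (fst c)
     else 0)"

definition rho_tilde ::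
    "(real ^ 2) set set \<Rightarrow> (real ^ 2) set \<Rightarrow> (cell \<Rightarrow> bit ^ 2) set" where
  "rho_tilde K P = coh_class (Xcells K P) W1 1 (rho_cochain K P)"


section \<open>Simple integrability\<close>

definition uniform_wave ::
    "(real ^ 2) set set \<Rightarrow> (real ^ 2) set \<Rightarrow> (cell \<Rightarrow> bit ^ 2) set \<Rightarrow> bool" where
  "uniform_wave K P \<rho> \<longleftrightarrow>
     \<rho> \<in> cohomology (X0cells K P) W1 1 \<and>
     (\<forall>v. interior_vertex K P v \<longrightarrow>
        restrict_coh (boundary_star K P v) W1 1 \<rho> =
        restrict_coh (boundary_star K P v) W1 1 (hessian K P (chi v)))"

definition rho_uniform :: "(real ^ 2) set set \<Rightarrow> (real ^ 2) set \<Rightarrow> bool" where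
  "rho_uniform K P \<longleftrightarrow> (\<exists>\<rho>. uniform_wave K P \<rho>)"

text \<open>
  A uniform wave is unique if it exists, because the boundaries of the stars of the interior
  vertices cover all 1-cells of \<open>X\<^sub>0\<close> and the stalks of \<open>W1\<close> at the 0-cells of \<open>X\<^sub>0\<close> vanish.
\<close>

definition simply_integrable :: "(real ^ 2) set set \<Rightarrow> (real ^ 2) set \<Rightarrow> bool" where
  "simply_integrable K P \<longleftrightarrow> rho_uniform K P \<and>
     (\<exists>\<rho>. uniform_wave K P \<rho> \<and>
        (\<exists>\<epsilon>\<in>C0 K. restrict_coh (X0cells K P) W1 1 (hessian K P \<epsilon>) = \<rho>))"

end

theory Submission
  imports Defs
begin

text \<open>
  The graph \<open>X\<close> is the dual graph of the triangulation with one more vertex \<open>[e,Q]\<close> for each boundary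
  edge \<open>e\<close>, joined to the triangle at \<open>e\<close>. The sheaf of waves vanishes at triangles and is a line at each
  edge, so coboundaries only reach the cells \<open>e\<^sup>*\<close> of boundary edges, where they are arbitrary
  (\<open>coboundaries_W1\<close>). Hence a class in \<open>H\<^sup>1(X; W\<^sub>1)\<close> is a family of elements of these lines over the
  interior edges, and \<open>\<nabla>\<^sup>2\<epsilon> = \<rho>\<close> is one scalar equation over \<open>F\<^sub>2\<close> for each interior edge.

  The vertices of a primitive triangle reduce to three distinct points of the four-point plane
  \<open>M\<^sub>2\<close> (\<open>red2_distinct_triangle\<close>). So \<open>\<epsilon>\<close> has a unique gradient on every triangle, and \<open>\<nabla>\<^sup>2\<epsilon>\<close> is the change
  of the gradient across interior edges (\<open>hessian_eq\<close>). Let \<open>e\<close> be an interior edge with endpoints \<open>a\<close>, \<open>b\<close>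
  and opposite vertices \<open>v\<^sub>1\<close>, \<open>v\<^sub>2\<close>. Modulo 2, either \<open>v\<^sub>1 = v\<^sub>2\<close> or \<open>a, b, v\<^sub>1, v\<^sub>2\<close> are all the points of \<open>M\<^sub>2\<close>;
  put \<open>\<rho>\<^sub>e = 0\<close> or \<open>\<rho>\<^sub>e = 1\<close> accordingly. Then the equation at \<open>e\<close> reads
  \<open>\<epsilon>(v\<^sub>1) + \<epsilon>(v\<^sub>2) + \<rho>\<^sub>e (\<epsilon>(a) + \<epsilon>(b)) = \<rho>\<^sub>e\<close> (\<open>edge_equation\<close>): \<open>\<epsilon>\<close> takes the same value at \<open>v\<^sub>1\<close> and \<open>v\<^sub>2\<close> in the
  first case, and its sum over the four points is \<open>1\<close> in the second.

  A function on \<open>M\<^sub>2\<close> satisfies this if its sum over \<open>M\<^sub>2\<close> is \<open>1\<close>, that is, if it is quadratic. Conversely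
  a solution agrees with some quadratic function on one triangle, and the equation propagates the
  agreement across interior edges to all of \<open>K\<close>, because the interior of \<open>P\<close> stays connected when the
  vertices are removed (\<open>triangles_connected\<close>).

  For simple integrability, observe that \<open>\<chi>\<^sub>v\<close> satisfies the equation at each interior edge \<open>e\<close> through \<open>v\<close>: it
  vanishes at \<open>v\<^sub>1\<close> and \<open>v\<^sub>2\<close>, and its values at \<open>a\<close> and \<open>b\<close> add up to \<open>1\<close>. So the Hessian of a quadratic
  function and that of \<open>\<chi>\<^sub>v\<close> agree around every interior vertex \<open>v\<close>.
\<close>

section \<open>The affine plane over the field with two elements\<close>

text \<open>
  By default sums and products of bits are rewritten to bit operations, about which the usual
  algebraic simplification rules know nothing.
\<close>

declare add_bit_eq_xor [simp del] mult_bit_eq_and [simp del]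

lemma bit_add_self [simp]: "(x::bit) + x = 0"
  by (cases x) simp_all

lemma bit_add_self_left [simp]: "(x::bit) + (x + y) = y"
  by (cases x) (simp_all flip: add.assoc)

lemma bit_add_eq_0_iff [simp]: "(x::bit) + y = 0 \<longleftrightarrow> x = y"
  by (cases x; cases y) simp_all

lemma bit2_eq_iff: "(p::bit^2) = q \<longleftrightarrow> p $ 1 = q $ 1 \<and> p $ 2 = q $ 2"
  by (simp add: vec_eq_iff forall_2)

lemma bit2_minus [simp]: "(p::bit^2) - q = p + q"
  by (simp add: bit2_eq_iff)

lemma bit2_add_self [simp]: "(p::bit^2) + p = 0"
  by (simp add: bit2_eq_iff)

lemma bit2_add_self_left [simp]: "(p::bit^2) + (p + q) = q"
  by (simp add: bit2_eq_iff)

lemma bit2_add_eq_0_iff: "(p::bit^2) + q = 0 \<longleftrightarrow> p = q"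
  by (simp add: bit2_eq_iff)

lemma pair2_expand: "pair2 p u = p $ 1 * u $ 1 + p $ 2 * u $ 2"
  by (simp add: pair2_def sum_2)

lemma pair2_add_left: "pair2 (p + q) u = pair2 p u + pair2 q u"
  by (simp add: pair2_expand algebra_simps)

lemma pair2_add_right: "pair2 p (u + w) = pair2 p u + pair2 p w"
  by (simp add: pair2_expand algebra_simps)

lemma pair2_scale_right: "pair2 p (c *s u) = c * pair2 p u"
  by (simp add: pair2_expand algebra_simps)

lemma pair2_zero_right [simp]: "pair2 p 0 = 0"
  by (simp add: pair2_expand)

text \<open>
  The quarter turn, without signs as the characteristic is two: it spans the orthogonal complement
  of a nonzero vector.
\<close>

definition quarter_turn2 :: "bit ^ 2 \<Rightarrow> bit ^ 2" where
  "quarter_turn2 d = (\<chi> i. if i = 1 then d $ 2 else d $ 1)"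

lemma quarter_turn2_nth [simp]: "quarter_turn2 d $ 1 = d $ 2" "quarter_turn2 d $ 2 = d $ 1"
  by (simp_all add: quarter_turn2_def)

lemma quarter_turn2_eq_0_iff [simp]: "quarter_turn2 d = 0 \<longleftrightarrow> d = 0"
  by (auto simp: bit2_eq_iff)

lemma quarter_turn2_inject [simp]: "quarter_turn2 d = quarter_turn2 e \<longleftrightarrow> d = e"
  by (auto simp: bit2_eq_iff)

lemma pair2_eq_0_iff:
  assumes "d \<noteq> 0"
  shows "pair2 d u = 0 \<longleftrightarrow> u = 0 \<or> u = quarter_turn2 d"
  using assms by (cases "d $ 1"; cases "d $ 2"; cases "u $ 1"; cases "u $ 2")
    (simp_all add: bit2_eq_iff pair2_expand)

text \<open>
  The plane over \<open>F\<^sub>2\<close> has only two vectors orthogonal to \<open>p + r \<noteq> 0\<close>, namely \<open>0\<close> and its own quarter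
  turn. So any three distinct points form an affine frame.
\<close>

lemma pair2_quarter_turn2:
  assumes "p \<noteq> q" "p \<noteq> r" "q \<noteq> r"
  shows "pair2 (p + r) (quarter_turn2 (p + q)) = 1"
proof -
  have "pair2 (p + r) (quarter_turn2 (p + q)) \<noteq> 0"
    using assms by (simp add: pair2_eq_0_iff bit2_add_eq_0_iff)
  then show ?thesis by simp
qed

text \<open>
  There are only three nonzero vectors, and their sum vanishes.
\<close>

lemma nonzero_sum2:
  assumes "(t::bit^2) \<noteq> 0" "d \<noteq> 0" "e \<noteq> 0" "d \<noteq> e" "t \<noteq> d" "t \<noteq> e"
  shows "t = d + e"
  using assms
  by (cases "t $ 1"; cases "t $ 2"; cases "d $ 1"; cases "d $ 2"; cases "e $ 1"; cases "e $ 2")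
    (simp_all add: bit2_eq_iff)

lemma fourth_point2:
  assumes "p \<noteq> q" "p \<noteq> r" "q \<noteq> r" and "p \<noteq> s" "q \<noteq> s" "r \<noteq> s"
  shows "s = p + q + (r::bit^2)"
proof -
  have "p + s \<noteq> 0" "p + q \<noteq> 0" "p + r \<noteq> 0" "p + q \<noteq> p + r" "p + s \<noteq> p + q" "p + s \<noteq> p + r"
    using assms by (simp_all add: bit2_add_eq_0_iff)
  then have "p + s = (p + q) + (p + r)"
    by (rule nonzero_sum2)
  then have "p + (p + s) = p + ((p + q) + (p + r))" by (rule arg_cong)
  then have "s = q + (p + r)" by (simp only: add.assoc bit2_add_self_left)
  then show ?thesis by (simp add: ac_simps)
qed

text \<open>
  For three distinct points, \<open>p + q\<close> and \<open>p + r\<close> are a basis of the plane, so a linear form is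
  determined by its values on them, and these can be prescribed.
\<close>

lemma gradient_unique:
  assumes "p \<noteq> q" "p \<noteq> r" "q \<noteq> r" and "pair2 (p + q) u = pair2 (p + q) w"
    and "pair2 (p + r) u = pair2 (p + r) w"
  shows "u = w"
proof -
  have "pair2 (p + q) (u + w) = 0" "pair2 (p + r) (u + w) = 0"
    using assms by (simp_all add: pair2_add_right)
  moreover have "p + q \<noteq> 0" using assms by (simp add: bit2_add_eq_0_iff)
  ultimately have "u + w = 0"
    using pair2_quarter_turn2[OF assms(1-3)] by (auto simp: pair2_eq_0_iff)
  then show ?thesis by (simp add: bit2_add_eq_0_iff)
qed

lemma gradient_exists:
  assumes "p \<noteq> q" "p \<noteq> r" "q \<noteq> r"
  obtains u where "pair2 (p + q) u = x" "pair2 (p + r) u = y"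
proof
  let ?u = "y *s quarter_turn2 (p + q) + x *s quarter_turn2 (p + r)"
  have 1: "pair2 d (quarter_turn2 d) = 0" for d by (simp add: pair2_expand mult.commute)
  show "pair2 (p + q) ?u = x" "pair2 (p + r) ?u = y"
    using 1 pair2_quarter_turn2[OF assms] pair2_quarter_turn2[of p r q] assms
    by (simp_all add: pair2_add_right pair2_scale_right)
qed

text \<open>
  In the next two definitions \<open>p\<close>, \<open>q\<close> are the reductions of the endpoints of an edge and \<open>r\<close>, \<open>s\<close>
  those of the two vertices opposite to it. As the plane has four points and \<open>r\<close>, \<open>s\<close> avoid \<open>p\<close>, \<open>q\<close>,
  either \<open>r = s\<close> or \<open>r + s = p + q\<close>: the parity is the factor \<open>\<rho>\<close> with \<open>r + s = \<rho> (p + q)\<close>. The second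
  function takes the values \<open>ep\<close>, \<open>eq\<close>, \<open>er\<close>, \<open>es\<close> of a 0-cochain at these vertices; it turns out to measure
  how much the gradient of the cochain changes across the edge.
\<close>

definition edge_parity :: "bit ^ 2 \<Rightarrow> bit ^ 2 \<Rightarrow> bit" where
  "edge_parity r s = (if r = s then 0 else 1)"

definition edge_jump :: "bit ^ 2 \<Rightarrow> bit ^ 2 \<Rightarrow> bit \<Rightarrow> bit \<Rightarrow> bit \<Rightarrow> bit \<Rightarrow> bit" where
  "edge_jump r s ep eq er es = er + es + edge_parity r s * (ep + eq)"

text \<open>
  Both gradients take the same value on \<open>p + q\<close>, so their sum lies on the line spanned by the
  quarter turn of \<open>p + q\<close>, and the factor is found by pairing with \<open>p + r\<close>: for \<open>r = s\<close> this is
  immediate, and otherwise \<open>p + r = (p + q) + (p + s)\<close> expresses it by the data of \<open>w\<close>.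
\<close>

lemma gradient_jump:
  assumes "p \<noteq> q" "p \<noteq> r" "q \<noteq> r" and "p \<noteq> s" "q \<noteq> s"
    and "pair2 (p + q) u = ep + eq" "pair2 (p + r) u = ep + er"
    and "pair2 (p + q) w = ep + eq" "pair2 (p + s) w = ep + es"
  shows "u + w = edge_jump r s ep eq er es *s quarter_turn2 (p + q)"
proof (rule gradient_unique[OF assms(1-3)])
  let ?g = "quarter_turn2 (p + q)"
  have "pair2 (p + q) ?g = 0" by (simp add: pair2_expand mult.commute)
  then show "pair2 (p + q) (u + w) = pair2 (p + q) (edge_jump r s ep eq er es *s ?g)"
    using assms by (simp add: pair2_add_right pair2_scale_right)
  have "pair2 (p + r) (u + w) = edge_jump r s ep eq er es"
  proof (cases "r = s")
    case True
    then show ?thesis using assms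
      by (simp add: pair2_add_right edge_jump_def edge_parity_def ac_simps)
  next
    case False
    then have "p + r = (p + q) + (p + s)"
      using fourth_point2[of p q s r] assms by (simp add: ac_simps)
    then have "pair2 (p + r) w = pair2 (p + q) w + pair2 (p + s) w"
      by (simp only: pair2_add_left[of "p + q" "p + s"])
    then have "pair2 (p + r) w = eq + es"
      using assms(8,9) by (simp add: ac_simps)
    then show ?thesis using assms False
      by (simp add: pair2_add_right edge_jump_def edge_parity_def ac_simps)
  qed
  then show "pair2 (p + r) (u + w) = pair2 (p + r) (edge_jump r s ep eq er es *s ?g)"
    using pair2_quarter_turn2[OF assms(1-3)] by (simp add: pair2_scale_right)
qed

text \<open>
  Summation over all points of the plane kills affine functions, and the monomial \<open>x y\<close> equals \<open>1\<close>
  at exactly one point.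
\<close>

lemma quadratic_function_sum_4:
  assumes Q: "quadratic_function Q" and "p \<noteq> q" "p \<noteq> r" "q \<noteq> r"
  shows "Q p + Q q + Q r + Q (p + q + r) = 1"
proof -
  obtain a b c where Q: "\<And>p. Q p = p $ 1 * p $ 2 + (a * p $ 1 + b * p $ 2 + c)"
    using Q by (auto simp: quadratic_function_def)
  have "Q p + Q q + Q r + Q (p + q + r) = pair2 (p + r) (quarter_turn2 (p + q))"
    by (simp add: Q pair2_expand algebra_simps)
  then show ?thesis using pair2_quarter_turn2[OF assms(2-4)] by simp
qed

text \<open>
  For \<open>r = s\<close> both sides vanish; otherwise \<open>p\<close>, \<open>q\<close>, \<open>r\<close>, \<open>s\<close> are all the points of the plane and the
  left-hand side is the sum of \<open>Q\<close> over them.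
\<close>

lemma quadratic_function_jump:
  assumes Q: "quadratic_function Q" and "p \<noteq> q" "p \<noteq> r" "q \<noteq> r" "p \<noteq> s" "q \<noteq> s"
  shows "edge_jump r s (Q p) (Q q) (Q r) (Q s) = edge_parity r s"
proof (cases "r = s")
  case False
  then have "s = p + q + r" using fourth_point2 assms by blast
  then show ?thesis
    using False quadratic_function_sum_4[OF assms(1-4)]
    by (simp add: edge_jump_def edge_parity_def ac_simps)
qed (simp add: edge_jump_def edge_parity_def)

text \<open>
  After subtracting \<open>x y\<close>, this is affine interpolation at an affine frame.
\<close>

lemma quadratic_function_interpolation:
  assumes "p \<noteq> q" "p \<noteq> r" "q \<noteq> r"
  obtains Q where "quadratic_function Q" "Q p = x" "Q q = y" "Q r = z"
proof -
  define h :: "bit ^ 2 \<Rightarrow> bit" where "h t = t $ 1 * t $ 2" for t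
  obtain u where u: "pair2 (p + q) u = x + y + (h p + h q)" "pair2 (p + r) u = x + z + (h p + h r)"
    using gradient_exists[OF assms] .
  define c where "c = x + h p + pair2 p u"
  define Q where "Q t = h t + (u $ 1 * t $ 1 + u $ 2 * t $ 2 + c)" for t
  have Qe: "Q t = h t + (pair2 t u + c)" for t
    by (simp add: Q_def pair2_expand mult.commute)
  have "quadratic_function Q"
    unfolding quadratic_function_def Q_def h_def by blast
  moreover have "Q p = x" by (simp add: Qe c_def ac_simps)
  moreover have "Q q = y"
  proof -
    have "pair2 q u = pair2 p u + pair2 (p + q) u" by (simp add: pair2_add_left)
    then show ?thesis by (simp add: Qe c_def u ac_simps)
  qed
  moreover have "Q r = z"
  proof -
    have "pair2 r u = pair2 p u + pair2 (p + r) u" by (simp add: pair2_add_left)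
    then show ?thesis by (simp add: Qe c_def u ac_simps)
  qed
  ultimately show thesis by (rule that)
qed

section \<open>Reduction modulo two\<close>

lemma zero_in_lattice: "0 \<in> lattice" by (simp add: lattice_def)

lemma red2_zero [simp]: "red2 0 = 0" by (simp add: red2_def vec_eq_iff)

lemma lattice_diff: "x \<in> lattice \<Longrightarrow> y \<in> lattice \<Longrightarrow> x - y \<in> lattice"
  by (simp add: lattice_def)

lemma red2_diff:
  assumes "x \<in> lattice" "y \<in> lattice"
  shows "red2 (x - y) = red2 x + red2 y"
proof -
  have "\<lfloor>x $ i - y $ i\<rfloor> = \<lfloor>x $ i\<rfloor> - \<lfloor>y $ i\<rfloor>" for i
  proof -
    obtain m n where "x $ i = of_int m" "y $ i = of_int n"
      using assms unfolding lattice_def Ints_def by blast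
    then show ?thesis by (metis floor_of_int of_int_diff)
  qed
  then show ?thesis by (simp add: red2_def vec_eq_iff)
qed

lemma pair2_red2:
  assumes "x \<in> lattice" "u \<in> lattice"
  shows "pair2 (red2 x) (red2 u) = of_int \<lfloor>x \<bullet> u\<rfloor>"
proof -
  obtain m n where x: "x $ 1 = of_int m" "x $ 2 = of_int n"
    using assms unfolding lattice_def Ints_def by blast
  obtain k l where u: "u $ 1 = of_int k" "u $ 2 = of_int l"
    using assms unfolding lattice_def Ints_def by blast
  have "x \<bullet> u = of_int (m * k + n * l)"
    by (simp add: inner_vec_def sum_2 x u)
  then have "\<lfloor>x \<bullet> u\<rfloor> = m * k + n * l" by (simp only: floor_of_int)
  then show ?thesis by (simp add: pair2_expand red2_def x u)
qed

section \<open>Sides of a line\<close>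

text \<open>
  The determinant of \<open>b - a\<close> and \<open>x - a\<close>: its sign tells on which side of the oriented line from \<open>a\<close>
  to \<open>b\<close> the point \<open>x\<close> lies, and its absolute value is twice the area of the triangle.
\<close>

definition side :: "real ^ 2 \<Rightarrow> real ^ 2 \<Rightarrow> real ^ 2 \<Rightarrow> real" where
  "side a b x = (b $ 1 - a $ 1) * (x $ 2 - a $ 2) - (b $ 2 - a $ 2) * (x $ 1 - a $ 1)"

text \<open>
  The vector \<open>b - a\<close> turned by a right angle, towards the positive side.
\<close>

definition normal :: "real ^ 2 \<Rightarrow> real ^ 2 \<Rightarrow> real ^ 2" where
  "normal a b = (\<chi> i. if i = 1 then a $ 2 - b $ 2 else b $ 1 - a $ 1)"

lemma normal_nth [simp]: "normal a b $ 1 = a $ 2 - b $ 2" "normal a b $ 2 = b $ 1 - a $ 1"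
  by (simp_all add: normal_def)

lemma real2_eq_iff: "(x::real^2) = y \<longleftrightarrow> x $ 1 = y $ 1 \<and> x $ 2 = y $ 2"
  by (simp add: vec_eq_iff forall_2)

lemma side_swap: "side b a x = - side a b x"
  by (simp add: side_def algebra_simps)

lemma normal_swap: "normal b a = - normal a b"
  by (simp add: real2_eq_iff)

lemma side_eq_inner: "side a b x = normal a b \<bullet> x - normal a b \<bullet> a"
  by (simp add: side_def inner_vec_def sum_2 algebra_simps)

lemma side_hull_le:
  assumes "x \<in> convex hull S" "\<And>y. y \<in> S \<Longrightarrow> side a b y \<le> 0"
  shows "side a b x \<le> 0"
proof -
  have "convex hull S \<subseteq> {y. normal a b \<bullet> y \<le> normal a b \<bullet> a}"
    using assms(2) by (intro hull_minimal convex_halfspace_le) (auto simp: side_eq_inner)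
  then show ?thesis using assms(1) by (auto simp: side_eq_inner)
qed

lemma side_endpoints [simp]: "side a b a = 0" "side a b b = 0"
  by (simp_all add: side_def)

lemma side_midpoint_shift: "side a b (midpoint a b + t *\<^sub>R normal a b) = t * (norm (b - a))\<^sup>2"
  unfolding side_def norm_eq_sqrt_inner
  by (simp add: midpoint_def inner_vec_def sum_2 power2_eq_square) (simp add: field_simps)

text \<open>
  In coordinates adapted to \<open>b - a\<close> and its normal, \<open>c\<close> has positive height \<open>h\<close>. Moving from the
  midpoint by \<open>t\<close> along the normal means giving \<open>c\<close> the barycentric coordinate \<open>g = t / h\<close>, and the
  coordinates of \<open>a\<close> and \<open>b\<close> stay close to \<open>1/2\<close>. Hence two triangles on the same side of a common
  edge overlap.
\<close>

lemma hull_contains_shift: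
  assumes "side a b c > 0"
  obtains \<delta> where "\<delta> > 0" "\<And>t. 0 < t \<Longrightarrow> t < \<delta> \<Longrightarrow> midpoint a b + t *\<^sub>R normal a b \<in> convex hull {a, b, c}"
proof -
  define N where "N = (b $ 1 - a $ 1)\<^sup>2 + (b $ 2 - a $ 2)\<^sup>2"
  define h where "h = side a b c / N"
  define s where "s = ((c $ 1 - a $ 1) * (b $ 1 - a $ 1) + (c $ 2 - a $ 2) * (b $ 2 - a $ 2)) / N"
  have "N \<noteq> 0"
  proof
    assume "N = 0"
    then have "b $ 1 = a $ 1" "b $ 2 = a $ 2" unfolding N_def by (simp_all add: sum_power2_eq_zero_iff)
    then show False using assms by (simp add: side_def)
  qed
  then have N: "N > 0" unfolding N_def by (simp add: sum_power2_gt_zero_iff)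
  then have h: "h > 0" using assms by (simp add: h_def)
  have c: "c = a + s *\<^sub>R (b - a) + h *\<^sub>R normal a b"
  proof -
    have sN: "s * N = (c $ 1 - a $ 1) * (b $ 1 - a $ 1) + (c $ 2 - a $ 2) * (b $ 2 - a $ 2)"
      and hN: "h * N = side a b c"
      using N by (simp_all add: s_def h_def)
    have "N * (a $ 1 + s * (b $ 1 - a $ 1) + h * (a $ 2 - b $ 2))
        = N * a $ 1 + (s * N) * (b $ 1 - a $ 1) + (h * N) * (a $ 2 - b $ 2)"
      by (simp add: algebra_simps)
    also have "\<dots> = N * c $ 1"
      unfolding sN hN by (simp add: N_def side_def power2_eq_square algebra_simps)
    finally have "N * (a $ 1 + s * (b $ 1 - a $ 1) + h * (a $ 2 - b $ 2)) = N * c $ 1" .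
    moreover have "N * (a $ 2 + s * (b $ 2 - a $ 2) + h * (b $ 1 - a $ 1))
        = N * a $ 2 + (s * N) * (b $ 2 - a $ 2) + (h * N) * (b $ 1 - a $ 1)"
      by (simp add: algebra_simps)
    moreover have "\<dots> = N * c $ 2"
      unfolding sN hN by (simp add: N_def side_def power2_eq_square algebra_simps)
    ultimately show ?thesis using N by (simp add: real2_eq_iff)
  qed
  \<comment> \<open>The factor makes \<open>g (1 + \<bar>s\<bar> + \<bar>1 - s\<bar>) < 1/2\<close>, so that all barycentric coordinates are nonnegative.\<close>
  define M where "M = 2 * (1 + \<bar>s\<bar> + \<bar>1 - s\<bar>)"
  have M: "M > 0" by (simp add: M_def add_pos_nonneg)
  show thesis
  proof (rule that[of "h / M"])
    show "h / M > 0" using h M by simp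
    fix t :: real assume t: "0 < t" "t < h / M"
    define g where "g = t / h"
    have g: "0 < g" "g * M < 1" using t h M by (simp_all add: g_def field_simps)
    have tg: "t = g * h" using h by (simp add: g_def)
    have "g * s \<le> g * \<bar>s\<bar>" "g * (1 - s) \<le> g * \<bar>1 - s\<bar>" using g by (simp_all add: mult_left_mono)
    moreover have "g * M = 2 * g + 2 * (g * \<bar>s\<bar>) + 2 * (g * \<bar>1 - s\<bar>)" by (simp add: M_def algebra_simps)
    moreover have "0 \<le> g * \<bar>s\<bar>" "0 \<le> g * \<bar>1 - s\<bar>" using g by simp_all
    ultimately have nn: "0 \<le> 1/2 - g * s" "0 \<le> 1/2 - g * (1 - s)" using g by linarith+
    have "midpoint a b + t *\<^sub>R normal a b
        = (1/2 - g * (1 - s)) *\<^sub>R a + (1/2 - g * s) *\<^sub>R b + g *\<^sub>R c"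
    proof -
      have m: "midpoint a b = (1/2) *\<^sub>R a + (1/2) *\<^sub>R b"
        by (simp add: midpoint_def scaleR_add_right)
      have gc: "g *\<^sub>R c = g *\<^sub>R a + (g * s) *\<^sub>R (b - a) + (g * h) *\<^sub>R normal a b"
        by (subst c) (simp add: scaleR_add_right)
      show ?thesis unfolding tg m gc by (simp add: algebra_simps)
    qed
    then show "midpoint a b + t *\<^sub>R normal a b \<in> convex hull {a, b, c}"
      unfolding convex_hull_3 using nn g
      by (intro CollectI exI[of _ "1/2 - g * (1 - s)"] exI[of _ "1/2 - g * s"] exI[of _ g] conjI)
        (simp_all add: algebra_simps)
  qed
qed

text \<open>
  In the plane a vector orthogonal to \<open>b - a\<close> is a multiple of the normal; this form of the
  statement avoids division.
\<close>

lemma orthogonal_in_plane: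
  fixes w z :: "real ^ 2"
  assumes "w \<bullet> (b - a) = 0"
  shows "(w \<bullet> z) * (norm (b - a))\<^sup>2 = (w \<bullet> normal a b) * (normal a b \<bullet> z)"
proof -
  define d where "d = b - a"
  have "(w \<bullet> z) * (d $ 1 * d $ 1 + d $ 2 * d $ 2) - (w $ 2 * d $ 1 - w $ 1 * d $ 2) * (d $ 1 * z $ 2 - d $ 2 * z $ 1)
    = (w \<bullet> d) * (d \<bullet> z)"
    by (simp add: inner_vec_def sum_2 algebra_simps)
  moreover have "w \<bullet> d = 0" using assms by (simp add: d_def)
  moreover have "(norm (b - a))\<^sup>2 = d $ 1 * d $ 1 + d $ 2 * d $ 2"
    unfolding power2_norm_eq_inner by (simp add: inner_vec_def sum_2 d_def)
  moreover have "w \<bullet> normal a b = w $ 2 * d $ 1 - w $ 1 * d $ 2"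
    and "normal a b \<bullet> z = d $ 1 * z $ 2 - d $ 2 * z $ 1"
    by (simp_all add: inner_vec_def sum_2 d_def algebra_simps)
  ultimately show ?thesis by simp
qed

text \<open>
  For the endpoints of an edge the reduced normal is the nonzero element of the stalk of waves there.
\<close>

lemma normal_in_lattice:
  assumes "p \<in> lattice" "q \<in> lattice"
  shows "normal p q \<in> lattice" "red2 (normal p q) = quarter_turn2 (red2 p + red2 q)"
proof -
  show "normal p q \<in> lattice" using assms by (simp add: lattice_def normal_def forall_2)
  have "p $ i \<in> \<int>" "q $ i \<in> \<int>" for i using assms by (simp_all add: lattice_def)
  then obtain k l m n where "p $ 1 = of_int k" "q $ 1 = of_int l" "p $ 2 = of_int m" "q $ 2 = of_int n"
    by (meson Ints_cases)
  then show "red2 (normal p q) = quarter_turn2 (red2 p + red2 q)"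
    by (simp add: bit2_eq_iff red2_def add.commute)
qed

section \<open>Primitive triangulations\<close>

lemma verts_hull:
  assumes "\<not> affine_dependent C" shows "verts (convex hull C) = C"
  using assms by (auto simp: verts_def extreme_point_of_convex_hull_affine_independent)

lemma aff_dim_hull:
  assumes "\<not> affine_dependent C" shows "aff_dim (convex hull C) = int (card C) - 1"
  using aff_dim_affine_independent[OF assms] by (simp add: aff_dim_convex_hull)

locale primitively_triangulated_polygon =
  fixes P :: "(real ^ 2) set" and K :: "(real ^ 2) set set"
  assumes polytope_P: "polytope P" and aff_dim_P: "aff_dim P = 2"
    and triangulation: "primitive_triangulation K P"
begin

lemma finite_K: "finite K"
  and Union_K: "\<Union>K = P"
  and face_in_K: "\<sigma> \<in> K \<Longrightarrow> F face_of \<sigma> \<Longrightarrow> F \<in> K"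
  and Int_face_of: "\<sigma> \<in> K \<Longrightarrow> \<tau> \<in> K \<Longrightarrow> (\<sigma> \<inter> \<tau>) face_of \<sigma>"
  and verts_in_lattice: "\<sigma> \<in> K \<Longrightarrow> v \<in> verts \<sigma> \<Longrightarrow> v \<in> lattice"
  using triangulation unfolding primitive_triangulation_def simplicial_complex_def by blast+

lemma in_triangle:
  assumes "\<sigma> \<in> K" obtains \<tau> where "\<tau> \<in> K" "aff_dim \<tau> = 2" "\<sigma> \<subseteq> \<tau>"
  using assms triangulation unfolding primitive_triangulation_def by blast

text \<open>
  In a simplicial complex the geometric inclusion of simplices already is the face relation. This
  translates the order of cells, which is defined by inclusion, into combinatorics.
\<close>

lemma subset_imp_face_of:
  assumes "\<sigma> \<in> K" "\<tau> \<in> K" "\<sigma> \<subseteq> \<tau>" shows "\<sigma> face_of \<tau>"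
  using Int_face_of[of \<tau> \<sigma>] assms by (simp add: Int_absorb1)

lemma simplex_hull:
  assumes "\<sigma> \<in> K"
  shows "\<not> affine_dependent (verts \<sigma>)" "finite (verts \<sigma>)" "\<sigma> = convex hull verts \<sigma>"
    "aff_dim \<sigma> = int (card (verts \<sigma>)) - 1"
proof -
  obtain C where "\<not> affine_dependent C" "\<sigma> = convex hull C"
  proof -
    have "simplicial_complex K" using triangulation by (simp add: primitive_triangulation_def)
    then have "\<exists>n. n simplex \<sigma>" using assms by (simp add: simplicial_complex_def)
    then show thesis using that by (auto simp: simplex_def)
  qed
  note C = this
  have "verts \<sigma> = C" using verts_hull C by blast
  then show "\<not> affine_dependent (verts \<sigma>)" "finite (verts \<sigma>)" "\<sigma> = convex hull verts \<sigma>"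
    "aff_dim \<sigma> = int (card (verts \<sigma>)) - 1"
    using C aff_dim_hull[OF C(1)] aff_independent_finite[OF C(1)] by simp_all
qed

lemma compact_K: "\<sigma> \<in> K \<Longrightarrow> compact \<sigma>" and convex_K: "\<sigma> \<in> K \<Longrightarrow> convex \<sigma>"
  using simplex_hull(2,3)[of \<sigma>] finite_imp_compact_convex_hull[of "verts \<sigma>"]
    convex_convex_hull[of "verts \<sigma>"] by simp_all

lemma closed_K: "\<sigma> \<in> K \<Longrightarrow> closed \<sigma>"
  by (simp add: compact_K compact_imp_closed)

lemma vertex_in_K: "\<sigma> \<in> K \<Longrightarrow> v \<in> verts \<sigma> \<Longrightarrow> {v} \<in> K"
  using face_in_K by (auto simp: verts_def face_of_singleton)

lemma verts_mono:
  assumes "\<sigma> \<in> K" "\<tau> \<in> K" "\<sigma> \<subseteq> \<tau>" shows "verts \<sigma> \<subseteq> verts \<tau>"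
  using extreme_point_of_face[OF subset_imp_face_of[OF assms]] by (auto simp: verts_def)

lemma edge_verts:
  assumes "e \<in> K" "aff_dim e = 1"
  obtains a b where "a \<noteq> b" "verts e = {a, b}" "e = convex hull {a, b}"
proof -
  have "card (verts e) = 2" using simplex_hull(4)[OF assms(1)] assms(2) by simp
  then obtain a b where "verts e = {a, b}" "a \<noteq> b" by (auto simp: card_2_iff)
  then show thesis using that simplex_hull(3)[OF assms(1)] by simp
qed

lemma triangle_over_edge:
  assumes "\<tau> \<in> K" "aff_dim \<tau> = 2" "e \<in> K" "e \<subseteq> \<tau>" "verts e = {a, b}" "a \<noteq> b"
  obtains c where "verts \<tau> = {a, b, c}" "\<tau> = convex hull {a, b, c}" "c \<noteq> a" "c \<noteq> b"
proof -
  have card: "card (verts \<tau>) = 3" using simplex_hull(4)[OF assms(1)] assms(2) by simp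
  have ab: "{a, b} \<subseteq> verts \<tau>" using verts_mono[OF assms(3,1,4)] assms(5) by simp
  then have "card (verts \<tau> - {a, b}) = 1" using card assms(6) by (simp add: card_Diff_subset)
  then obtain c where c: "verts \<tau> - {a, b} = {c}" by (auto simp: card_1_singleton_iff)
  then have v: "verts \<tau> = {a, b, c}" using ab by blast
  have "\<tau> = convex hull {a, b, c}" using simplex_hull(3)[OF assms(1)] unfolding v .
  moreover have "c \<noteq> a" "c \<noteq> b" using c by blast+
  ultimately show thesis using that v by blast
qed

lemma triangle_verts:
  assumes "\<tau> \<in> K" "aff_dim \<tau> = 2"
  obtains a b c where "verts \<tau> = {a, b, c}" "\<tau> = convex hull {a, b, c}" "a \<noteq> b" "a \<noteq> c" "b \<noteq> c"
proof -
  have "card (verts \<tau>) = 3" using simplex_hull(4)[OF assms(1)] assms(2) by simp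
  then obtain a b c where "verts \<tau> = {a, b, c}" "a \<noteq> b" "a \<noteq> c" "b \<noteq> c"
    by (auto simp: card_3_iff)
  then show thesis using that simplex_hull(3)[OF assms(1)] by simp
qed

lemma abs_side_triangle:
  assumes "\<tau> \<in> K" "aff_dim \<tau> = 2" "verts \<tau> = {a, b, c}"
  shows "\<bar>side a b c\<bar> = 1"
proof -
  have t: "\<tau> = convex hull {a, b, c}" using simplex_hull(3)[OF assms(1)] assms(3) by simp
  have "measure lborel \<tau> = 1 / 2"
    using assms triangulation unfolding primitive_triangulation_def by blast
  then show ?thesis unfolding t content_triangle by (simp add: side_def mult.commute)
qed

text \<open>
  Two lattice points that agree modulo 2 differ by twice a lattice vector, which makes the
  determinant even. So the vertices of a primitive triangle are three of the four points of the
  affine plane over \<open>F\<^sub>2\<close>.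
\<close>

lemma red2_distinct_triangle:
  assumes "\<tau> \<in> K" "aff_dim \<tau> = 2" "verts \<tau> = {a, b, c}"
  shows "red2 a \<noteq> red2 b" "red2 a \<noteq> red2 c" "red2 b \<noteq> red2 c"
proof -
  have lat: "a \<in> lattice" "b \<in> lattice" "c \<in> lattice"
    using verts_in_lattice[OF assms(1)] assms(3) by auto
  have distinct: "red2 p \<noteq> red2 q" if "p \<in> lattice" "q \<in> lattice" "r \<in> lattice" "\<bar>side p q r\<bar> = 1" for p q r
  proof
    assume eq: "red2 p = red2 q"
    have n: "normal p q \<in> lattice" "red2 (normal p q) = 0"
      using normal_in_lattice[OF that(1,2)] eq by simp_all
    have "side p q r = (r - p) \<bullet> normal p q"
      by (simp add: side_eq_inner inner_commute[of _ "normal p q"] inner_diff_right)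
    then have "of_int \<lfloor>side p q r\<rfloor> = (0 :: bit)"
      using pair2_red2[OF lattice_diff[OF that(3,1)] n(1)] n(2) by simp
    moreover have "side p q r = 1 \<or> side p q r = -1" using that(4) by linarith
    moreover have "\<lfloor>- 1 :: real\<rfloor> = - 1" using floor_of_int[of "- 1", where 'a = real] by simp
    ultimately show False by auto
  qed
  show "red2 a \<noteq> red2 b" "red2 a \<noteq> red2 c" "red2 b \<noteq> red2 c"
    using distinct[of a b c] distinct[of a c b] distinct[of b c a] lat
      abs_side_triangle[OF assms(1,2), of a b c] abs_side_triangle[OF assms(1,2), of a c b]
      abs_side_triangle[OF assms(1,2), of b c a] assms(3)
    by (simp_all add: insert_commute)
qed

lemma interior_P_nonempty: "interior P \<noteq> {}"
proof -
  have "aff_dim P = int (DIM(real ^ 2))" using aff_dim_P by simp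
  then have "interior P = rel_interior P" by (simp add: interior_rel_interior_gen)
  moreover have "P \<noteq> {}" using aff_dim_P by auto
  ultimately show ?thesis using polytope_P by (simp add: rel_interior_eq_empty polytope_imp_convex)
qed

lemma convex_P: "convex P" and closed_P: "closed P"
  using polytope_P by (simp_all add: polytope_imp_convex polytope_imp_closed)

lemma rel_interior_P: "rel_interior P = interior P" and rel_frontier_P: "rel_frontier P = frontier P"
  using interior_P_nonempty rel_interior_nonempty_interior rel_frontier_nonempty_interior by blast+

lemma subset_P: "\<sigma> \<in> K \<Longrightarrow> \<sigma> \<subseteq> P"
  using Union_K by blast

text \<open>
  Near the midpoint of the edge both triangles contain the same points off the line through \<open>a\<close> and
  \<open>b\<close>. So their intersection, which is a common face, is not contained in that line and has to
  contain the apices.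
\<close>

lemma triangle_side_unique:
  assumes \<tau>: "\<tau> \<in> K" "aff_dim \<tau> = 2" "verts \<tau> = {a, b, c}"
    and \<tau>': "\<tau>' \<in> K" "aff_dim \<tau>' = 2" "verts \<tau>' = {a, b, c'}"
    and side: "side a b c > 0" "side a b c' > 0"
  shows "\<tau> = \<tau>'"
proof -
  have subset: "\<tau> \<subseteq> \<tau>'"
    if \<tau>: "\<tau> \<in> K" "aff_dim \<tau> = 2" "verts \<tau> = {a, b, c}"
    and \<tau>': "\<tau>' \<in> K" "aff_dim \<tau>' = 2" "verts \<tau>' = {a, b, c'}"
    and side: "side a b c > 0" "side a b c' > 0" for \<tau> \<tau>' c c'
  proof -
    have h: "\<tau> = convex hull {a, b, c}" "\<tau>' = convex hull {a, b, c'}"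
      using simplex_hull(3)[OF \<tau>(1)] simplex_hull(3)[OF \<tau>'(1)] \<tau>(3) \<tau>'(3) by simp_all
    obtain d where d: "d > 0" "\<And>t. 0 < t \<Longrightarrow> t < d \<Longrightarrow> midpoint a b + t *\<^sub>R normal a b \<in> \<tau>"
      using hull_contains_shift[OF side(1)] h by metis
    obtain d' where d': "d' > 0" "\<And>t. 0 < t \<Longrightarrow> t < d' \<Longrightarrow> midpoint a b + t *\<^sub>R normal a b \<in> \<tau>'"
      using hull_contains_shift[OF side(2)] h by metis
    define t where "t = min d d' / 2"
    define x where "x = midpoint a b + t *\<^sub>R normal a b"
    have t: "0 < t" "t < d" "t < d'" using d d' by (auto simp: t_def)
    have "a \<noteq> b" using side(1) by (auto simp: side_def)
    then have sx: "side a b x > 0" using t by (simp add: x_def side_midpoint_shift)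
    have x: "x \<in> \<tau> \<inter> \<tau>'" using t d d' by (simp add: x_def)
    have "\<tau> \<inter> \<tau>' \<in> K" using Int_face_of face_in_K \<tau> \<tau>' by blast
    have "c \<in> verts (\<tau> \<inter> \<tau>')"
    proof (rule ccontr)
      assume "c \<notin> verts (\<tau> \<inter> \<tau>')"
      then have "verts (\<tau> \<inter> \<tau>') \<subseteq> {a, b}"
        using verts_mono[OF \<open>\<tau> \<inter> \<tau>' \<in> K\<close> \<tau>(1)] \<tau>(3) by auto
      moreover have "x \<in> convex hull verts (\<tau> \<inter> \<tau>')"
        using x simplex_hull(3)[OF \<open>\<tau> \<inter> \<tau>' \<in> K\<close>] by simp
      ultimately have "x \<in> convex hull {a, b}" using hull_mono by blast
      then have "side a b x \<le> 0" by (rule side_hull_le) auto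
      then show False using sx by simp
    qed
    then have "c \<in> \<tau>'" by (auto simp: verts_def extreme_point_of_def)
    moreover have "{a, b} \<subseteq> \<tau>'" unfolding h using hull_subset[of "{a,b,c'}" convex] by auto
    moreover have "convex \<tau>'" using convex_K \<tau>' by simp
    ultimately show ?thesis unfolding h(1) by (intro hull_minimal) auto
  qed
  show ?thesis using subset[OF \<tau> \<tau>' side] subset[OF \<tau>' \<tau> side(2,1)] by blast
qed

lemma midpoint_rel_interior: "a \<noteq> (b :: real^2) \<Longrightarrow> midpoint a b \<in> rel_interior (convex hull {a, b})"
  using rel_interior_closed_segment[of a b] midpoint_in_open_segment[of a b]
  by (simp add: segment_convex_hull)

text \<open>
  Points close to the midpoint of \<open>e\<close> lie only in simplices that contain the midpoint, and such a
  simplex contains all of \<open>e\<close>, as the midpoint is in the relative interior of \<open>e\<close>.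
\<close>

lemma triangle_side_exists:
  assumes e: "e \<in> K" "verts e = {a, b}" "a \<noteq> b"
    and d: "d > 0" "\<And>t. 0 < t \<Longrightarrow> t < d \<Longrightarrow> midpoint a b + t *\<^sub>R normal a b \<in> P"
  obtains \<tau> c where "\<tau> \<in> K" "aff_dim \<tau> = 2" "e \<subseteq> \<tau>" "verts \<tau> = {a, b, c}" "side a b c > 0"
proof -
  define m where "m = midpoint a b"
  define T where "T = {\<tau> \<in> K. m \<notin> \<tau>}"
  have he: "e = convex hull {a, b}" using simplex_hull(3)[OF e(1)] e(2) by simp
  have "closed (\<Union>T)" using finite_K closed_K by (intro closed_Union) (auto simp: T_def)
  then have "open (- \<Union>T)" by (rule open_Compl)
  moreover have "m \<in> - \<Union>T" by (auto simp: T_def)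
  ultimately obtain r where r: "r > 0" "ball m r \<subseteq> - \<Union>T" by (meson open_contains_ball)
  have n: "norm (normal a b) > 0" using e(3) by (auto simp: real2_eq_iff)
  \<comment> \<open>Small enough to stay in \<open>P\<close> and in the ball that misses the simplices without \<open>m\<close>.\<close>
  define t where "t = min (d / 2) (r / (2 * norm (normal a b)))"
  define x where "x = m + t *\<^sub>R normal a b"
  have t: "0 < t" "t < d" using d(1) r(1) n by (auto simp: t_def)
  have "t * norm (normal a b) \<le> r / (2 * norm (normal a b)) * norm (normal a b)"
    using n by (intro mult_right_mono) (auto simp: t_def)
  also have "\<dots> < r" using r n by simp
  finally have "x \<in> ball m r" using t by (simp add: x_def dist_norm)
  moreover have "x \<in> P" using d(2) t by (simp add: x_def m_def)
  ultimately obtain \<sigma> where "\<sigma> \<in> K" "x \<in> \<sigma>" "m \<in> \<sigma>" using r(2) Union_K by (force simp: T_def)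
  then obtain \<tau> where \<tau>: "\<tau> \<in> K" "aff_dim \<tau> = 2" "x \<in> \<tau>" "m \<in> \<tau>" by (metis in_triangle subsetD)
  have mr: "m \<in> rel_interior e" using midpoint_rel_interior e(3) he by (simp add: m_def)
  have "e \<subseteq> e \<inter> \<tau>"
  proof (rule subset_of_face_of)
    show "e \<inter> \<tau> face_of e" by (rule Int_face_of) (fact e(1), fact \<tau>(1))
    show "e \<inter> \<tau> \<inter> rel_interior e \<noteq> {}" using mr \<tau>(4) rel_interior_subset by blast
  qed simp
  then have "e \<subseteq> \<tau>" by blast
  obtain c where c: "verts \<tau> = {a, b, c}" "\<tau> = convex hull {a, b, c}"
    using triangle_over_edge[OF \<tau>(1,2) e(1) \<open>e \<subseteq> \<tau>\<close> e(2,3)] .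
  have "side a b x > 0" using t e(3) by (simp add: x_def m_def side_midpoint_shift)
  then have "side a b c > 0"
    using side_hull_le[of x "{a, b, c}" a b] \<tau>(3) c(2) by force
  then show thesis using that \<tau> \<open>e \<subseteq> \<tau>\<close> c by blast
qed

section \<open>Triangles and sides at an edge\<close>

definition adjacent_triangles :: "(real ^ 2) set \<Rightarrow> (real ^ 2) set set" where
  "adjacent_triangles e = {\<tau> \<in> K. aff_dim \<tau> = 2 \<and> e \<subseteq> \<tau>}"

lemma adjacentD: "\<tau> \<in> adjacent_triangles e \<Longrightarrow> \<tau> \<in> K \<and> aff_dim \<tau> = 2 \<and> e \<subseteq> \<tau>"
  by (simp add: adjacent_triangles_def)

text \<open>
  For a boundary edge \<open>e\<close> this is a single side \<open>Q\<close>, which gives an endpoint \<open>[e,Q]\<close> of \<open>e\<^sup>*\<close> in \<open>X\<close>; for an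
  interior edge there is none.
\<close>

definition sides_over :: "(real ^ 2) set \<Rightarrow> (real ^ 2) set set" where
  "sides_over e = {Q. Q face_of P \<and> aff_dim Q = 1 \<and> e \<subseteq> Q}"

lemma triangle_side_cases:
  assumes "\<tau> \<in> K" "aff_dim \<tau> = 2" "verts \<tau> = {a, b, c}"
  shows "side a b c > 0 \<or> side b a c > 0"
  using abs_side_triangle[OF assms] side_swap[of b a c] by linarith

text \<open>
  The configuration at an interior edge: two triangles joined along it like the leaves of a hinge.
\<close>

definition hinge ::
    "(real ^ 2) set \<Rightarrow> real ^ 2 \<Rightarrow> real ^ 2 \<Rightarrow> real ^ 2 \<Rightarrow> real ^ 2
      \<Rightarrow> (real ^ 2) set \<Rightarrow> (real ^ 2) set \<Rightarrow> bool" where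
  "hinge e a b c1 c2 \<tau>1 \<tau>2 \<longleftrightarrow>
     e \<in> K \<and> verts e = {a, b} \<and> a \<noteq> b \<and> adjacent_triangles e = {\<tau>1, \<tau>2} \<and> \<tau>1 \<noteq> \<tau>2 \<and>
     verts \<tau>1 = {a, b, c1} \<and> verts \<tau>2 = {a, b, c2} \<and> c1 \<notin> {a, b} \<and> c2 \<notin> {a, b} \<and> c1 \<noteq> c2"

lemma hingeD:
  assumes "hinge e a b c1 c2 \<tau>1 \<tau>2"
  shows "e \<in> K" "verts e = {a, b}" "a \<noteq> b"
    "adjacent_triangles e = {\<tau>1, \<tau>2}" "\<tau>1 \<noteq> \<tau>2"
    "verts \<tau>1 = {a, b, c1}" "verts \<tau>2 = {a, b, c2}" "c1 \<notin> {a, b}" "c2 \<notin> {a, b}" "c1 \<noteq> c2"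
    "\<tau>1 \<in> K" "aff_dim \<tau>1 = 2" "\<tau>2 \<in> K" "aff_dim \<tau>2 = 2"
  using assms adjacentD[of \<tau>1 e] adjacentD[of \<tau>2 e] by (simp_all add: hinge_def)

lemma hinge_red2:
  assumes "hinge e a b c1 c2 \<tau>1 \<tau>2"
  shows "red2 a \<noteq> red2 b" "red2 a \<noteq> red2 c1" "red2 b \<noteq> red2 c1" "red2 a \<noteq> red2 c2" "red2 b \<noteq> red2 c2"
  using red2_distinct_triangle[OF hingeD(11,12,6)[OF assms]]
    red2_distinct_triangle[OF hingeD(13,14,7)[OF assms]] by auto

text \<open>
  The midpoint of an interior edge is an interior point of \<open>P\<close>, so there is a triangle on each side
  of the edge, and there is no room for another one. Exchanging \<open>a\<close> and \<open>b\<close> exchanges the sides.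
\<close>

lemma interior_edge_hinge:
  assumes e: "e \<in> K" "verts e = {a, b}" "a \<noteq> b" and int: "interior_simplex P e"
  obtains c1 c2 \<tau>1 \<tau>2 where "hinge e a b c1 c2 \<tau>1 \<tau>2"
proof -
  have he: "e = convex hull {a, b}" using simplex_hull(3)[OF e(1)] unfolding e(2) .
  have "rel_interior e \<subseteq> rel_interior P"
  proof (rule subset_rel_interior_convex)
    show "e \<subseteq> closure P" using subset_P[OF e(1)] closure_subset by blast
    show "\<not> e \<subseteq> rel_frontier P" using int by (simp add: interior_simplex_def rel_frontier_P)
  qed (use convex_K[OF e(1)] convex_P in auto)
  then have "midpoint a b \<in> interior P"
    using midpoint_rel_interior[OF e(3)] unfolding rel_interior_P he by blast
  then obtain r where r: "r > 0" "ball (midpoint a b) r \<subseteq> P"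
    by (meson mem_interior)
  have n: "norm (normal a b) > 0" using e(3) by (auto simp: real2_eq_iff)
  define d where "d = r / norm (normal a b)"
  have d: "d > 0" using r n by (simp add: d_def)
  have inP: "midpoint a b + t *\<^sub>R normal a b \<in> P" if "\<bar>t\<bar> < d" for t
  proof -
    have "\<bar>t\<bar> * norm (normal a b) < r" using that n by (simp add: d_def field_simps)
    then have "midpoint a b + t *\<^sub>R normal a b \<in> ball (midpoint a b) r" by (simp add: dist_norm)
    then show ?thesis using r by blast
  qed
  have inP0: "midpoint a b + t *\<^sub>R normal a b \<in> P" if "0 < t" "t < d" for t
    using inP[of t] that by simp
  obtain \<tau>1 c1 where 1: "\<tau>1 \<in> K" "aff_dim \<tau>1 = 2" "e \<subseteq> \<tau>1" "verts \<tau>1 = {a, b, c1}" "side a b c1 > 0"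
    using triangle_side_exists[OF e d inP0] .
  have inP': "midpoint b a + t *\<^sub>R normal b a \<in> P" if "0 < t" "t < d" for t
    using inP[of "- t"] that by (simp add: midpoint_sym[of b a] normal_swap[of b a])
  have e': "e \<in> K" "verts e = {b, a}" "b \<noteq> a" using e by auto
  obtain \<tau>2 c2 where 2: "\<tau>2 \<in> K" "aff_dim \<tau>2 = 2" "e \<subseteq> \<tau>2" "verts \<tau>2 = {b, a, c2}" "side b a c2 > 0"
    using triangle_side_exists[OF e' d inP'] .
  have c: "c1 \<notin> {a, b}" "c2 \<notin> {a, b}" "c1 \<noteq> c2"
    using 1(5) 2(5) side_swap[of b a] by auto
  have neq: "\<tau>1 \<noteq> \<tau>2" using 1(4) 2(4) c by auto
  have adj: "adjacent_triangles e = {\<tau>1, \<tau>2}"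
  proof (intro equalityI subsetI)
    fix \<tau> assume "\<tau> \<in> adjacent_triangles e"
    then have \<tau>: "\<tau> \<in> K" "aff_dim \<tau> = 2" "e \<subseteq> \<tau>" by (auto simp: adjacent_triangles_def)
    obtain c where c: "verts \<tau> = {a, b, c}" using triangle_over_edge[OF \<tau>(1,2) e(1) \<tau>(3) e(2,3)] .
    have "verts \<tau> = {b, a, c}" using c by auto
    then show "\<tau> \<in> {\<tau>1, \<tau>2}"
      using triangle_side_cases[OF \<tau>(1,2) c] triangle_side_unique[OF \<tau>(1,2) c 1(1,2,4) _ 1(5)]
        triangle_side_unique[OF \<tau>(1,2) _ 2(1,2,4) _ 2(5)] by blast
  qed (use 1 2 in \<open>auto simp: adjacent_triangles_def\<close>)
  have v2: "verts \<tau>2 = {a, b, c2}" using 2(4) by auto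
  have "hinge e a b c1 c2 \<tau>1 \<tau>2" unfolding hinge_def using e adj neq 1(4) v2 c by simp
  then show thesis by (rule that)
qed

text \<open>
  A supporting line of \<open>P\<close> at the midpoint of a boundary edge has to contain the edge, so that all
  apices over the edge lie on the same side of it.
\<close>

lemma adjacent_triangles_boundary:
  assumes e: "e \<in> K" "aff_dim e = 1" and bd: "\<not> interior_simplex P e"
  obtains \<tau> where "adjacent_triangles e = {\<tau>}"
proof -
  obtain a b where ab: "a \<noteq> b" "verts e = {a, b}" "e = convex hull {a, b}"
    using edge_verts[OF e] .
  have abP: "a \<in> P" "b \<in> P" using ab(3) subset_P[OF e(1)] hull_subset[of "{a, b}" convex] by auto
  have "midpoint a b \<in> e" unfolding ab(3) segment_convex_hull[symmetric] by simp
  then have m: "midpoint a b \<in> P" "midpoint a b \<notin> rel_interior P"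
    using bd subset_P[OF e(1)] by (auto simp: interior_simplex_def rel_interior_P frontier_def)
  obtain w where w: "w \<noteq> 0" "\<And>y. y \<in> P \<Longrightarrow> w \<bullet> midpoint a b \<le> w \<bullet> y"
    using supporting_hyperplane_rel_boundary[OF convex_P m] by metis
  have "2 * (w \<bullet> midpoint a b) = w \<bullet> a + w \<bullet> b"
    by (simp add: midpoint_def inner_add_right)
  then have "w \<bullet> midpoint a b = w \<bullet> a \<and> w \<bullet> a = w \<bullet> b"
    using w(2)[OF abP(1)] w(2)[OF abP(2)] by argo
  then have wab: "w \<bullet> a = w \<bullet> b" "w \<bullet> midpoint a b = w \<bullet> a" by simp_all
  \<comment> \<open>The functional \<open>w\<close> is \<open>k\<close> times the one defining \<open>side a b\<close>, up to a positive factor.\<close>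
  define k where "k = w \<bullet> normal a b"
  have wz: "(w \<bullet> z) * (norm (b - a))\<^sup>2 = k * (normal a b \<bullet> z)" for z
    unfolding k_def by (rule orthogonal_in_plane) (simp add: wab inner_diff_right)
  have "k \<noteq> 0" using wz[of w] w(1) ab(1) by auto
  have nonneg: "k * side a b c \<ge> 0" if "\<tau> \<in> K" "verts \<tau> = {a, b, c}" for \<tau> c
  proof -
    have "c \<in> \<tau>" using that by (auto simp: verts_def extreme_point_of_def)
    then have "c \<in> P" using subset_P that by blast
    then have "0 \<le> w \<bullet> (c - a)" using w(2) wab(2) by (simp add: inner_diff_right)
    then have "0 \<le> (w \<bullet> (c - a)) * (norm (b - a))\<^sup>2" by simp
    then show ?thesis unfolding wz by (simp add: side_eq_inner inner_diff_right)
  qed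
  have unique: "\<tau> = \<tau>'" if "\<tau> \<in> adjacent_triangles e" "\<tau>' \<in> adjacent_triangles e" for \<tau> \<tau>'
  proof -
    have \<tau>: "\<tau> \<in> K" "aff_dim \<tau> = 2" "e \<subseteq> \<tau>" and \<tau>': "\<tau>' \<in> K" "aff_dim \<tau>' = 2" "e \<subseteq> \<tau>'"
      using that by (auto simp: adjacent_triangles_def)
    obtain c where c: "verts \<tau> = {a, b, c}" using triangle_over_edge[OF \<tau>(1,2) e(1) \<tau>(3) ab(2,1)] .
    obtain c' where c': "verts \<tau>' = {a, b, c'}" using triangle_over_edge[OF \<tau>'(1,2) e(1) \<tau>'(3) ab(2,1)] .
    have c2: "verts \<tau> = {b, a, c}" "verts \<tau>' = {b, a, c'}" using c c' by auto
    have s: "k * side a b c \<ge> 0" "k * side a b c' \<ge> 0" using nonneg \<tau> \<tau>' c c' by auto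
    have "(side a b c > 0 \<and> side a b c' > 0) \<or> (side b a c > 0 \<and> side b a c' > 0)"
    proof (cases "k > 0")
      case True
      then have "side a b c \<ge> 0" "side a b c' \<ge> 0" using s by (simp_all add: zero_le_mult_iff)
      then show ?thesis using triangle_side_cases[OF \<tau>(1,2) c] triangle_side_cases[OF \<tau>'(1,2) c'] side_swap[of b a] by auto
    next
      case False
      then have "side a b c \<le> 0" "side a b c' \<le> 0" using s \<open>k \<noteq> 0\<close> by (simp_all add: zero_le_mult_iff)
      then show ?thesis using triangle_side_cases[OF \<tau>(1,2) c] triangle_side_cases[OF \<tau>'(1,2) c'] side_swap[of b a] by auto
    qed
    then show ?thesis
      using triangle_side_unique[OF \<tau>(1,2) c \<tau>'(1,2) c'] triangle_side_unique[OF \<tau>(1,2) c2(1) \<tau>'(1,2) c2(2)] by blast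
  qed
  obtain \<tau> where "\<tau> \<in> K" "aff_dim \<tau> = 2" "e \<subseteq> \<tau>" using in_triangle[OF e(1)] .
  then have "\<tau> \<in> adjacent_triangles e" by (simp add: adjacent_triangles_def)
  then have "adjacent_triangles e = {\<tau>}" using unique by blast
  then show thesis by (rule that)
qed

lemma proper_face_frontier: "Q face_of P \<Longrightarrow> Q \<noteq> P \<Longrightarrow> Q \<subseteq> frontier P"
  using face_of_subset_rel_frontier[of Q P] by (simp add: rel_frontier_P)

lemma sides_over_interior:
  assumes "interior_simplex P e" shows "sides_over e = {}"
  using assms proper_face_frontier aff_dim_P by (fastforce simp: sides_over_def interior_simplex_def)

text \<open>
  A point in the relative interior of the edge lies on a facet of \<open>P\<close>, which then contains the whole
  edge. Two such facets meet in a face of dimension one and therefore coincide.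
\<close>

lemma sides_over_boundary:
  assumes e: "e \<in> K" "aff_dim e = 1" and bd: "\<not> interior_simplex P e"
  obtains Q where "sides_over e = {Q}"
proof -
  have "rel_interior e \<noteq> {}"
    using e convex_K[OF e(1)] by (auto simp: rel_interior_eq_empty)
  then obtain x where x: "x \<in> rel_interior e" by blast
  have "rel_interior e \<subseteq> e" by (rule rel_interior_subset)
  then have "x \<in> rel_frontier P" using bd x by (auto simp: interior_simplex_def rel_frontier_P)
  then obtain Q where Q: "Q facet_of P" "x \<in> Q"
    using rel_frontier_of_polyhedron[OF polytope_imp_polyhedron[OF polytope_P]] by blast
  then have "Q face_of P" "aff_dim Q = 1" using aff_dim_P by (simp_all add: facet_of_def)
  moreover from this(1) have "e \<subseteq> Q" by (rule subset_of_face_of) (use subset_P[OF e(1)] Q x in auto)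
  ultimately have Q: "Q \<in> sides_over e" by (simp add: sides_over_def)
  have le: "Q1 \<subseteq> Q2" if "Q1 \<in> sides_over e" "Q2 \<in> sides_over e" for Q1 Q2
  proof -
    have f: "Q1 \<inter> Q2 face_of P" using that by (auto simp: sides_over_def intro: face_of_Int)
    then have "Q1 \<inter> Q2 face_of Q1"
      using that by (intro face_of_subset[OF f]) (auto simp: sides_over_def dest: face_of_imp_subset)
    moreover have "aff_dim e \<le> aff_dim (Q1 \<inter> Q2)" using that by (intro aff_dim_subset) (auto simp: sides_over_def)
    moreover have "convex Q1" using that by (auto simp: sides_over_def dest: face_of_imp_convex)
    ultimately have "Q1 \<inter> Q2 = Q1"
      using face_of_aff_dim_lt[of Q1 "Q1 \<inter> Q2"] that e(2) by (auto simp: sides_over_def)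
    then show ?thesis by blast
  qed
  have "sides_over e = {Q}" using Q le[OF Q] le[OF _ Q] by blast
  then show thesis by (rule that)
qed

text \<open>
  Each edge \<open>e\<^sup>*\<close> of the graph \<open>X\<close> has exactly two endpoints: two triangles, or one triangle and one
  side of the polygon.
\<close>

lemma two_sided:
  assumes "e \<in> K" "aff_dim e = 1"
  shows "finite (adjacent_triangles e)" "finite (sides_over e)"
    and "card (adjacent_triangles e) + card (sides_over e) = 2"
proof -
  obtain a b where ab: "a \<noteq> b" "verts e = {a, b}" using edge_verts[OF assms] .
  have "finite (adjacent_triangles e) \<and> finite (sides_over e) \<and> card (adjacent_triangles e) + card (sides_over e) = 2"
  proof (cases "interior_simplex P e")
    case True
    obtain c1 c2 \<tau>1 \<tau>2 where "hinge e a b c1 c2 \<tau>1 \<tau>2"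
      using interior_edge_hinge[OF assms(1) ab(2,1) True] .
    then have "adjacent_triangles e = {\<tau>1, \<tau>2}" "\<tau>1 \<noteq> \<tau>2" by (simp_all add: hinge_def)
    then show ?thesis using sides_over_interior[OF True] by simp
  next
    case False
    obtain \<tau> where "adjacent_triangles e = {\<tau>}" using adjacent_triangles_boundary[OF assms False] .
    moreover obtain Q where "sides_over e = {Q}" using sides_over_boundary[OF assms False] .
    ultimately show ?thesis by simp
  qed
  then show "finite (adjacent_triangles e)" "finite (sides_over e)"
    and "card (adjacent_triangles e) + card (sides_over e) = 2" by auto
qed

section \<open>Connectedness of the dual graph\<close>

text \<open>
  Any two triangles are joined by a chain of triangles in which neighbours share an interior edge.
  Otherwise two families of triangles without a common edge would cover \<open>P\<close>. Triangles from
  different families then meet at most in vertices, so the families would disconnect the interior of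
  \<open>P\<close> minus the finitely many vertices, which is impossible in dimension two.
\<close>

lemma triangles_connected:
  assumes S: "S \<subseteq> {\<tau> \<in> K. aff_dim \<tau> = 2}" "S \<noteq> {}"
    and step: "\<And>e \<tau> \<tau>'. e \<in> K \<Longrightarrow> aff_dim e = 1 \<Longrightarrow> interior_simplex P e \<Longrightarrow> \<tau> \<in> S
      \<Longrightarrow> \<tau> \<in> adjacent_triangles e \<Longrightarrow> \<tau>' \<in> adjacent_triangles e \<Longrightarrow> \<tau>' \<in> S"
  shows "S = {\<tau> \<in> K. aff_dim \<tau> = 2}"
proof (rule ccontr)
  assume neq: "S \<noteq> {\<tau> \<in> K. aff_dim \<tau> = 2}"
  define S' where "S' = {\<tau> \<in> K. aff_dim \<tau> = 2} - S"
  have S': "S' \<noteq> {}" using neq S(1) by (auto simp: S'_def)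
  define V where "V = {v. {v} \<in> K}"
  have "inj_on (\<lambda>v. {v}) V" by simp
  moreover have "(\<lambda>v. {v}) ` V \<subseteq> K" by (auto simp: V_def)
  ultimately have finV: "finite V" using finite_K by (meson inj_on_finite)
  define U where "U = interior P - V"
  have "connected U"
    unfolding U_def
    by (rule connected_open_diff_countable)
      (use finV convex_P in \<open>auto simp: uncountable_infinite intro: countable_finite convex_connected convex_interior\<close>)
  moreover have "closed (\<Union>S)" "closed (\<Union>S')"
    using S(1) finite_K closed_K by (auto simp: S'_def intro!: closed_Union intro: finite_subset)
  moreover have "U \<subseteq> \<Union>S \<union> \<Union>S'"
  proof
    fix x assume "x \<in> U"
    then have "x \<in> P" using interior_subset by (auto simp: U_def)
    then obtain \<sigma> where "\<sigma> \<in> K" "x \<in> \<sigma>" using Union_K by blast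
    then obtain \<tau> where "\<tau> \<in> K" "aff_dim \<tau> = 2" "x \<in> \<tau>" by (metis in_triangle subsetD)
    then show "x \<in> \<Union>S \<union> \<Union>S'" by (auto simp: S'_def)
  qed
  moreover have "\<Union>S \<inter> \<Union>S' \<inter> U = {}"
  proof (rule ccontr)
    assume "\<Union>S \<inter> \<Union>S' \<inter> U \<noteq> {}"
    then obtain x \<tau> \<tau>' where x: "x \<in> U" "\<tau> \<in> S" "\<tau>' \<in> S'" "x \<in> \<tau>" "x \<in> \<tau>'" by blast
    have \<tau>: "\<tau> \<in> K" "aff_dim \<tau> = 2" "\<tau>' \<in> K" "aff_dim \<tau>' = 2" "\<tau> \<noteq> \<tau>'" "\<tau>' \<notin> S"
      using x S(1) by (auto simp: S'_def)
    define e where "e = \<tau> \<inter> \<tau>'"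
    have f: "e face_of \<tau>" "e face_of \<tau>'"
      using Int_face_of[OF \<tau>(1,3)] Int_face_of[OF \<tau>(3,1)] by (simp_all add: e_def Int_commute)
    then have eK: "e \<in> K" using face_in_K \<tau> by blast
    have "e \<noteq> \<tau> \<or> e \<noteq> \<tau>'" using \<tau> by auto
    then have lt: "aff_dim e < 2"
      using face_of_aff_dim_lt[OF convex_K[OF \<tau>(1)] f(1)] face_of_aff_dim_lt[OF convex_K[OF \<tau>(3)] f(2)] \<tau> by auto
    have xe: "x \<in> e" using x by (simp add: e_def)
    have "aff_dim e \<noteq> 0"
    proof
      assume "aff_dim e = 0"
      then have "e = {x}" using xe by (auto simp: aff_dim_eq_0)
      then show False using eK x(1) by (simp add: U_def V_def)
    qed
    moreover have "\<not> aff_dim e < 0" using xe by (auto simp: aff_dim_negative_iff)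
    ultimately have e1: "aff_dim e = 1" using lt by linarith
    have adj: "\<tau> \<in> adjacent_triangles e" "\<tau>' \<in> adjacent_triangles e"
      using \<tau> by (auto simp: adjacent_triangles_def e_def)
    have "interior_simplex P e"
    proof (rule ccontr)
      assume "\<not> interior_simplex P e"
      then obtain \<sigma> where "adjacent_triangles e = {\<sigma>}"
        using adjacent_triangles_boundary[OF eK e1] by blast
      then show False using adj \<tau>(5) by simp
    qed
    then show False using step[OF eK e1 _ x(2) adj] \<tau>(6) by simp
  qed
  moreover have meets: "\<Union>T \<inter> U \<noteq> {}" if T: "T \<subseteq> {\<tau> \<in> K. aff_dim \<tau> = 2}" "T \<noteq> {}" for T
  proof -
    obtain \<tau> where \<tau>: "\<tau> \<in> T" "\<tau> \<in> K" "aff_dim \<tau> = 2" using T by blast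
    have "interior \<tau> = rel_interior \<tau>" using \<tau>(3) by (simp add: interior_rel_interior_gen)
    moreover have "\<tau> \<noteq> {}" using \<tau>(3) by auto
    ultimately have "interior \<tau> \<noteq> {}" using convex_K[OF \<tau>(2)] by (simp add: rel_interior_eq_empty)
    then have "infinite (interior \<tau>)"
      using finite_imp_not_open open_interior by blast
    then have "interior \<tau> - V \<noteq> {}" using finV by (metis Diff_eq_empty_iff finite_subset)
    moreover have "interior \<tau> \<subseteq> interior P" using subset_P[OF \<tau>(2)] by (rule interior_mono)
    moreover have "interior \<tau> \<subseteq> \<tau>" by (rule interior_subset)
    ultimately show ?thesis using \<tau>(1) unfolding U_def by blast
  qed
  moreover have "\<Union>S \<inter> U \<noteq> {}" using S by (rule meets)
  moreover have "\<Union>S' \<inter> U \<noteq> {}" using _ S' by (rule meets) (auto simp: S'_def)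
  ultimately show False unfolding connected_closed by blast
qed

section \<open>The graph dual to the triangulation\<close>

abbreviation "X \<equiv> Xcells K P"

lemma P_face: "P face_of P" by (simp add: face_of_refl convex_P)

lemma sides_overD: "Q \<in> sides_over e \<Longrightarrow> Q face_of P \<and> aff_dim Q = 1 \<and> e \<subseteq> Q \<and> Q \<noteq> P"
  using aff_dim_P by (auto simp: sides_over_def)

lemma triangle_cell: "\<tau> \<in> K \<Longrightarrow> aff_dim \<tau> = 2 \<Longrightarrow> (\<tau>, P) \<in> X \<and> cell_dim (\<tau>, P) = 0"
  using P_face subset_P aff_dim_P by (auto simp: Xcells_def Ycells_def cell_dim_def)

lemma dual_edge_cell: "e \<in> K \<Longrightarrow> aff_dim e = 1 \<Longrightarrow> (e, P) \<in> X \<and> cell_dim (e, P) = 1"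
  using P_face subset_P aff_dim_P by (auto simp: Xcells_def Ycells_def cell_dim_def)

lemma side_cell: "e \<in> K \<Longrightarrow> aff_dim e = 1 \<Longrightarrow> Q \<in> sides_over e \<Longrightarrow> (e, Q) \<in> X \<and> cell_dim (e, Q) = 0"
  by (auto simp: Xcells_def Ycells_def cell_dim_def sides_over_def)

text \<open>
  The graph \<open>X\<close> has two kinds of vertices, the triangles and the boundary edges \<open>[e,Q]\<close>, and its edges
  are the cells \<open>e\<^sup>* = [e,P]\<close>.
\<close>

lemma Xcells_cases:
  assumes "c \<in> X"
  obtains (triangle) \<tau> where "\<tau> \<in> K" "aff_dim \<tau> = 2" "c = (\<tau>, P)"
    | (dual_edge) e where "e \<in> K" "aff_dim e = 1" "c = (e, P)"
    | (side) e Q where "e \<in> K" "aff_dim e = 1" "Q \<in> sides_over e" "c = (e, Q)"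
proof -
  obtain \<sigma> Q where c: "c = (\<sigma>, Q)" and \<sigma>: "\<sigma> \<in> K" "\<sigma> \<subseteq> Q" "aff_dim \<sigma> \<ge> 1" and Q: "Q face_of P"
    using assms by (cases c) (auto simp: Xcells_def Ycells_def)
  have le: "aff_dim \<sigma> \<le> aff_dim Q" using \<sigma>(2) by (rule aff_dim_subset)
  show thesis
  proof (cases "Q = P")
    case True
    have "aff_dim \<sigma> \<le> 2" using le aff_dim_P True by simp
    then have "aff_dim \<sigma> = 1 \<or> aff_dim \<sigma> = 2" using \<sigma>(3) by linarith
    then show thesis using triangle[of \<sigma>] dual_edge[of \<sigma>] \<sigma>(1) c True by blast
  next
    case False
    have "aff_dim Q < 2" using face_of_aff_dim_lt[OF convex_P Q False] aff_dim_P by simp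
    then have "aff_dim \<sigma> = 1" "aff_dim Q = 1" using le \<sigma>(3) by linarith+
    then show thesis using side[of \<sigma> Q] \<sigma> Q c by (simp add: sides_over_def)
  qed
qed

lemma cell_dim_1_cases:
  assumes "c \<in> X" "cell_dim c = 1"
  obtains e where "e \<in> K" "aff_dim e = 1" "c = (e, P)"
  using assms(1)
proof (cases rule: Xcells_cases)
  case (triangle \<tau>)
  then show thesis using triangle_cell[of \<tau>] assms(2) by simp
next
  case (side e Q)
  then show thesis using side_cell[of e Q] assms(2) by simp
qed (rule that)

lemma cell_dim_le_1: "c \<in> X \<Longrightarrow> cell_dim c \<le> 1"
  by (erule Xcells_cases) (use triangle_cell dual_edge_cell side_cell in fastforce)+

lemma cells_below:
  assumes e: "e \<in> K" "aff_dim e = 1"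
  shows "{c' \<in> X. cell_le c' (e, P) \<and> cell_dim (e, P) = Suc (cell_dim c')}
    = (\<lambda>\<tau>. (\<tau>, P)) ` adjacent_triangles e \<union> (\<lambda>Q. (e, Q)) ` sides_over e" (is "?L = ?R")
proof (intro equalityI subsetI)
  fix c assume "c \<in> ?L"
  then have c: "c \<in> X" "e \<subseteq> fst c" "cell_dim c = 0" using dual_edge_cell[OF e] by (auto simp: cell_le_def)
  from c(1) show "c \<in> ?R"
  proof (cases rule: Xcells_cases)
    case (triangle \<tau>)
    then show ?thesis using c(2) by (auto simp: adjacent_triangles_def)
  next
    case (dual_edge e')
    then show ?thesis using c(3) dual_edge_cell[of e'] by simp
  next
    case (side e' Q)
    have "e face_of e'" using subset_imp_face_of[OF e(1) side(1)] c(2) side(4) by simp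
    then have "e = e'" using face_of_aff_dim_lt[OF convex_K[OF side(1)], of e] e(2) side(2) by auto
    then show ?thesis using side by simp
  qed
next
  fix c assume "c \<in> ?R"
  then show "c \<in> ?L"
  proof
    assume "c \<in> (\<lambda>\<tau>. (\<tau>, P)) ` adjacent_triangles e"
    then obtain \<tau> where \<tau>: "\<tau> \<in> adjacent_triangles e" "c = (\<tau>, P)" by blast
    then show ?thesis using adjacentD[OF \<tau>(1)] triangle_cell[of \<tau>] dual_edge_cell[OF e] by (simp add: cell_le_def)
  next
    assume "c \<in> (\<lambda>Q. (e, Q)) ` sides_over e"
    then obtain Q where Q: "Q \<in> sides_over e" "c = (e, Q)" by blast
    then show ?thesis
      using sides_overD[OF Q(1)] side_cell[OF e Q(1)] dual_edge_cell[OF e] face_of_imp_subset[of Q P]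
      by (simp add: cell_le_def)
  qed
qed

lemma sum_cells_below:
  fixes f :: "cell \<Rightarrow> 'b::comm_monoid_add"
  assumes e: "e \<in> K" "aff_dim e = 1"
  shows "sum f ((\<lambda>\<tau>. (\<tau>, P)) ` adjacent_triangles e \<union> (\<lambda>Q. (e, Q)) ` sides_over e)
    = (\<Sum>\<tau>\<in>adjacent_triangles e. f (\<tau>, P)) + (\<Sum>Q\<in>sides_over e. f (e, Q))"
proof -
  have "(\<lambda>\<tau>. (\<tau>, P)) ` adjacent_triangles e \<inter> (\<lambda>Q. (e, Q)) ` sides_over e = {}"
    by (auto dest: sides_overD)
  then have "sum f ((\<lambda>\<tau>. (\<tau>, P)) ` adjacent_triangles e \<union> (\<lambda>Q. (e, Q)) ` sides_over e)
    = sum f ((\<lambda>\<tau>. (\<tau>, P)) ` adjacent_triangles e) + sum f ((\<lambda>Q. (e, Q)) ` sides_over e)"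
    using two_sided[OF e] by (intro sum.union_disjoint) auto
  also have "sum f ((\<lambda>\<tau>. (\<tau>, P)) ` adjacent_triangles e) = (\<Sum>\<tau>\<in>adjacent_triangles e. f (\<tau>, P))"
    by (subst sum.reindex) (auto simp: inj_on_def)
  also have "sum f ((\<lambda>Q. (e, Q)) ` sides_over e) = (\<Sum>Q\<in>sides_over e. f (e, Q))"
    by (subst sum.reindex) (auto simp: inj_on_def)
  finally show ?thesis .
qed

definition subcomplex :: "cell set \<Rightarrow> bool" where
  "subcomplex A \<longleftrightarrow> A \<subseteq> X \<and> (\<forall>c\<in>A. \<forall>c'\<in>X. cell_le c' c \<longrightarrow> c' \<in> A)"

lemma subcomplex_X: "subcomplex X" by (simp add: subcomplex_def)

lemma coboundary_dual_edge:
  assumes A: "subcomplex A" and e: "e \<in> K" "aff_dim e = 1" "(e, P) \<in> A"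
  shows "coboundary A G f (e, P) = (\<Sum>\<tau>\<in>adjacent_triangles e. res G (\<tau>, P) (e, P) (f (\<tau>, P)))
     + (\<Sum>Q\<in>sides_over e. res G (e, Q) (e, P) (f (e, Q)))"
proof -
  have "{c' \<in> A. cell_le c' (e, P) \<and> cell_dim (e, P) = Suc (cell_dim c')}
    = {c' \<in> X. cell_le c' (e, P) \<and> cell_dim (e, P) = Suc (cell_dim c')}"
    using A e(3) by (auto simp: subcomplex_def)
  then show ?thesis
    using e(3) by (simp add: coboundary_def cells_below[OF e(1,2)] sum_cells_below[OF e(1,2)])
qed

lemma coboundary_eq_0:
  assumes "A \<subseteq> X" "\<not> (c \<in> A \<and> cell_dim c = 1)"
  shows "coboundary A G f c = 0"
proof (cases "c \<in> A")
  case True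
  then have "cell_dim c = 0" using assms cell_dim_le_1[of c] by force
  then show ?thesis by (simp add: coboundary_def)
qed (simp add: coboundary_def)

lemma cochainsD: "f \<in> cochains A G q \<Longrightarrow> c \<in> A \<Longrightarrow> cell_dim c = q \<Longrightarrow> f c \<in> stalk G c"
  and cochainsD0: "f \<in> cochains A G q \<Longrightarrow> \<not> (c \<in> A \<and> cell_dim c = q) \<Longrightarrow> f c = 0"
  unfolding cochains_def by blast+

lemma cochainsI:
  assumes "\<And>c. c \<in> A \<Longrightarrow> cell_dim c = q \<Longrightarrow> f c \<in> stalk G c"
    and "\<And>c. \<not> (c \<in> A \<and> cell_dim c = q) \<Longrightarrow> f c = 0"
  shows "f \<in> cochains A G q"
  using assms unfolding cochains_def by blast

lemma W1_simps [simp]: "stalk W1 c = W1_stalk (fst c)" "res W1 c' c u = u"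
  by (simp_all add: W1_def)

text \<open>
  In a graph there are no 2-cells.
\<close>

lemma cocycles_W1:
  assumes "A \<subseteq> X" shows "cocycles A W1 1 = cochains A W1 1"
proof -
  have "coboundary A W1 f c = 0" if f: "f \<in> cochains A W1 1" for f c
  proof (cases "c \<in> A \<and> cell_dim c = 1")
    case True
    have "f c' = 0" if "cell_dim c = Suc (cell_dim c')" for c'
    proof -
      have "cell_dim c' \<noteq> 1" using True that by simp
      then show ?thesis using f unfolding cochains_def by blast
    qed
    then show ?thesis by (simp add: coboundary_def)
  qed (use assms coboundary_eq_0 in blast)
  then show ?thesis by (auto simp: cocycles_def fun_eq_iff)
qed

section \<open>Stalks of the sheaf of waves\<close>

lemma zero_in_W1_stalk [simp]: "0 \<in> W1_stalk \<sigma>"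
  unfolding W1_stalk_def by (rule image_eqI[of _ _ 0]) (simp_all add: zero_in_lattice)

lemma W1_stalk_orthogonal:
  assumes "u \<in> W1_stalk \<sigma>" "\<sigma> \<in> K" "a \<in> verts \<sigma>" "b \<in> verts \<sigma>"
  shows "pair2 (red2 a + red2 b) u = 0"
proof -
  obtain w where w: "w \<in> lattice" "u = red2 w" "\<And>x y. x \<in> \<sigma> \<Longrightarrow> y \<in> \<sigma> \<Longrightarrow> (x - y) \<bullet> w = 0"
    using assms(1) by (auto simp: W1_stalk_def)
  have lat: "a \<in> lattice" "b \<in> lattice" using assms verts_in_lattice by auto
  have "a \<in> \<sigma>" "b \<in> \<sigma>" using assms(3,4) by (auto simp: verts_def extreme_point_of_def)
  then have "(a - b) \<bullet> w = 0" by (rule w(3))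
  then show ?thesis using pair2_red2[OF lattice_diff[OF lat] w(1)] by (simp add: red2_diff lat w(2))
qed

text \<open>
  A form that is constant on an affine frame vanishes.
\<close>

lemma W1_stalk_triangle:
  assumes \<tau>: "\<tau> \<in> K" "aff_dim \<tau> = 2" shows "W1_stalk \<tau> = {0}"
proof -
  obtain a b c where v: "verts \<tau> = {a, b, c}" using triangle_verts[OF \<tau>] .
  have "u = 0" if "u \<in> W1_stalk \<tau>" for u
    by (rule gradient_unique[OF red2_distinct_triangle[OF \<tau> v]])
      (use W1_stalk_orthogonal[OF that \<tau>(1)] v in auto)
  then show ?thesis by auto
qed

lemma edge_in_triangle_red2:
  assumes "e \<in> K" "verts e = {a, b}" "a \<noteq> b"
  shows "red2 a \<noteq> red2 b"
proof -
  obtain \<tau> where \<tau>: "\<tau> \<in> K" "aff_dim \<tau> = 2" "e \<subseteq> \<tau>" using in_triangle[OF assms(1)] .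
  obtain c where "verts \<tau> = {a, b, c}" using triangle_over_edge[OF \<tau>(1,2) assms(1) \<tau>(3) assms(2,3)] .
  then show ?thesis by (rule red2_distinct_triangle[OF \<tau>(1,2)])
qed

text \<open>
  The stalk consists of forms orthogonal to the nonzero vector \<open>a + b\<close> modulo 2, which leaves two
  candidates; the nonzero one is the reduction of the integral normal vector.
\<close>

lemma W1_stalk_edge:
  assumes e: "e \<in> K" "verts e = {a, b}" "a \<noteq> b"
  shows "W1_stalk e = {0, quarter_turn2 (red2 a + red2 b)}"
proof (intro equalityI subsetI)
  fix u assume "u \<in> W1_stalk e"
  then have "pair2 (red2 a + red2 b) u = 0" using W1_stalk_orthogonal e by blast
  moreover have "red2 a + red2 b \<noteq> 0" using edge_in_triangle_red2[OF e] by (simp add: bit2_add_eq_0_iff)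
  ultimately show "u \<in> {0, quarter_turn2 (red2 a + red2 b)}" by (simp add: pair2_eq_0_iff)
next
  fix u assume u: "u \<in> {0, quarter_turn2 (red2 a + red2 b)}"
  have lat: "a \<in> lattice" "b \<in> lattice" using verts_in_lattice[OF e(1)] e(2) by auto
  have r: "red2 (normal a b) = quarter_turn2 (red2 a + red2 b)"
    using normal_in_lattice[OF lat] by simp
  have "(x - y) \<bullet> normal a b = 0" if "x \<in> e" "y \<in> e" for x y
  proof -
    have "side a b z = 0" if "z \<in> e" for z
    proof -
      have z: "z \<in> convex hull {a, b}" using simplex_hull(3)[OF e(1)] that unfolding e(2) by simp
      have "side a b z \<le> 0" "side b a z \<le> 0" by (rule side_hull_le[OF z], auto)+
      then show ?thesis using side_swap[of b a z] by simp
    qed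
    then have "side a b x = 0" "side a b y = 0" using that by auto
    then show ?thesis by (simp add: side_eq_inner inner_commute[of _ "normal a b"] inner_diff_right)
  qed
  then have "quarter_turn2 (red2 a + red2 b) \<in> W1_stalk e"
    using normal_in_lattice[OF lat] unfolding r[symmetric] W1_stalk_def by blast
  then show "u \<in> W1_stalk e" using u by auto
qed

lemma W1_generator_edge:
  assumes e: "e \<in> K" "verts e = {a, b}" "a \<noteq> b"
  shows "W1_generator e = quarter_turn2 (red2 a + red2 b)" "W1_generator e \<noteq> 0"
proof -
  have "red2 a + red2 b \<noteq> 0" using edge_in_triangle_red2[OF e] by (simp add: bit2_add_eq_0_iff)
  then have ne: "quarter_turn2 (red2 a + red2 b) \<noteq> 0" by simp
  show "W1_generator e = quarter_turn2 (red2 a + red2 b)"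
    unfolding W1_generator_def W1_stalk_edge[OF e] using ne by (intro the_equality) auto
  then show "W1_generator e \<noteq> 0" using ne by simp
qed

lemma W1_stalk_add:
  assumes "u \<in> W1_stalk \<sigma>" "w \<in> W1_stalk \<sigma>" shows "u + w \<in> W1_stalk \<sigma>"
proof -
  obtain u' w' where "u' \<in> lattice" "u = red2 u'" "\<And>x y. x \<in> \<sigma> \<Longrightarrow> y \<in> \<sigma> \<Longrightarrow> (x - y) \<bullet> u' = 0"
    "w' \<in> lattice" "w = red2 w'" "\<And>x y. x \<in> \<sigma> \<Longrightarrow> y \<in> \<sigma> \<Longrightarrow> (x - y) \<bullet> w' = 0"
    using assms by (auto simp: W1_stalk_def)
  then show ?thesis
    unfolding W1_stalk_def
    by (intro image_eqI[of _ _ "u' - w'"]) (simp_all add: red2_diff lattice_diff inner_diff_right)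
qed

section \<open>Cohomology classes of waves\<close>

definition interior_edge :: "(real ^ 2) set \<Rightarrow> bool" where
  "interior_edge e \<longleftrightarrow> e \<in> K \<and> aff_dim e = 1 \<and> interior_simplex P e"

text \<open>
  A cohomology class of waves on a subcomplex \<open>A\<close> of \<open>X\<close>, described by the common values \<open>h\<close> of its
  cocycles on interior edges. The values on boundary edges are arbitrary.
\<close>

definition wave_class :: "cell set \<Rightarrow> ((real ^ 2) set \<Rightarrow> bit ^ 2) \<Rightarrow> (cell \<Rightarrow> bit ^ 2) set" where
  "wave_class A h = {w \<in> cochains A W1 1. \<forall>e. interior_edge e \<and> (e, P) \<in> A \<longrightarrow> w (e, P) = h e}"

text \<open>
  The families that are the values of some wave.
\<close>

definition wave_values :: "((real ^ 2) set \<Rightarrow> bit ^ 2) \<Rightarrow> bool" where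
  "wave_values h \<longleftrightarrow> (\<forall>e. interior_edge e \<longrightarrow> h e \<in> W1_stalk e)"

lemma wave_class_nonempty:
  assumes "A \<subseteq> X" "wave_values h"
  shows "(\<lambda>c. if c \<in> A \<and> interior_edge (fst c) \<and> snd c = P then h (fst c) else 0) \<in> wave_class A h"
    (is "?w \<in> _")
proof -
  have "?w \<in> cochains A W1 1"
  proof (rule cochainsI)
    fix c assume "c \<in> A" "cell_dim c = 1"
    then show "?w c \<in> stalk W1 c" using assms(2) by (simp add: wave_values_def)
  next
    fix c assume c: "\<not> (c \<in> A \<and> cell_dim c = 1)"
    show "?w c = 0"
    proof (cases "interior_edge (fst c) \<and> snd c = P")
      case True
      then have "cell_dim c = 1" using dual_edge_cell[of "fst c"] by (cases c) (simp add: interior_edge_def)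
      then show ?thesis using c by simp
    qed auto
  qed
  then show ?thesis by (simp add: wave_class_def)
qed

lemma wave_class_eq_iff:
  assumes "A \<subseteq> X" "wave_values h"
  shows "wave_class A h = wave_class A h' \<longleftrightarrow> (\<forall>e. interior_edge e \<and> (e, P) \<in> A \<longrightarrow> h e = h' e)"
proof
  assume eq: "wave_class A h = wave_class A h'"
  obtain w where w: "w \<in> wave_class A h" using wave_class_nonempty[OF assms(1,2)] by blast
  then have "w \<in> wave_class A h'" unfolding eq .
  with w show "\<forall>e. interior_edge e \<and> (e, P) \<in> A \<longrightarrow> h e = h' e" by (auto simp: wave_class_def)
qed (auto simp: wave_class_def)

lemma W1_stalk_sum: "finite I \<Longrightarrow> (\<And>i. i \<in> I \<Longrightarrow> f i \<in> W1_stalk \<sigma>) \<Longrightarrow> sum f I \<in> W1_stalk \<sigma>"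
  by (induction I rule: finite_induct) (auto intro: W1_stalk_add)

text \<open>
  The stalks at triangles vanish, so a 0-cochain is a family of values at the vertices \<open>[e,Q]\<close>. Such a
  vertex lies on the single edge \<open>e\<^sup>*\<close>, where the stalk is the same line, and \<open>e\<close> is a boundary edge. Thus
  coboundaries are exactly the cochains that vanish on interior edges.
\<close>

lemma coboundaries_W1:
  assumes A: "subcomplex A"
  shows "coboundaries A W1 1 = wave_class A (\<lambda>_. 0)"
proof -
  have AX: "A \<subseteq> X" using A by (simp add: subcomplex_def)
  have triangle0: "f (\<tau>, P) = 0" if "f \<in> cochains A W1 0" "\<tau> \<in> adjacent_triangles e" for f \<tau> e
  proof -
    have \<tau>: "\<tau> \<in> K" "aff_dim \<tau> = 2" using adjacentD[OF that(2)] by auto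
    show ?thesis
      using cochainsD[OF that(1), of "(\<tau>, P)"] cochainsD0[OF that(1), of "(\<tau>, P)"] W1_stalk_triangle[OF \<tau>]
      by fastforce
  qed
  have cob: "coboundary A W1 f (e, P) = (\<Sum>Q\<in>sides_over e. f (e, Q))"
    if "f \<in> cochains A W1 0" "e \<in> K" "aff_dim e = 1" "(e, P) \<in> A" for f e
    using coboundary_dual_edge[OF A that(2-4), of W1 f] triangle0[OF that(1)] by simp
  show ?thesis
  proof (intro equalityI subsetI)
    fix w assume "w \<in> coboundaries A W1 1"
    then obtain f where f: "f \<in> cochains A W1 0" and w: "w = coboundary A W1 f" by auto
    have "w \<in> cochains A W1 1"
    proof (rule cochainsI)
      fix c assume c: "c \<in> A" "cell_dim c = 1"
      obtain e where e: "e \<in> K" "aff_dim e = 1" "c = (e, P)"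
        using cell_dim_1_cases[of c] c AX by blast
      have "f (e, Q) \<in> W1_stalk e" for Q
        using cochainsD[OF f, of "(e, Q)"] cochainsD0[OF f, of "(e, Q)"] by fastforce
      then have "(\<Sum>Q\<in>sides_over e. f (e, Q)) \<in> W1_stalk e" using two_sided[OF e(1,2)] by (intro W1_stalk_sum)
      then show "w c \<in> stalk W1 c" using cob[OF f e(1,2)] c(1) e(3) w by simp
    qed (use coboundary_eq_0[OF AX] w in blast)
    moreover have "w (e, P) = 0" if "interior_edge e" "(e, P) \<in> A" for e
      using cob[OF f, of e] that sides_over_interior[of e] by (simp add: w interior_edge_def)
    ultimately show "w \<in> wave_class A (\<lambda>_. 0)" by (simp add: wave_class_def)
  next
    fix w assume "w \<in> wave_class A (\<lambda>_. 0)"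
    then have w: "w \<in> cochains A W1 1" and w0: "\<And>e. interior_edge e \<Longrightarrow> (e, P) \<in> A \<Longrightarrow> w (e, P) = 0"
      by (auto simp: wave_class_def)
    define f where "f c = (if c \<in> A \<and> cell_dim c = 0 \<and> snd c \<noteq> P then w (fst c, P) else 0)" for c
    have f: "f \<in> cochains A W1 0"
    proof (rule cochainsI)
      fix c :: cell
      have "w (fst c, P) \<in> W1_stalk (fst c)"
        using cochainsD[OF w, of "(fst c, P)"] cochainsD0[OF w, of "(fst c, P)"] by fastforce
      then show "f c \<in> stalk W1 c" by (simp add: f_def)
    qed (auto simp: f_def)
    have "coboundary A W1 f c = w c" for c
    proof (cases "c \<in> A \<and> cell_dim c = 1")
      case True
      then obtain e where e: "e \<in> K" "aff_dim e = 1" "c = (e, P)"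
        using cell_dim_1_cases[of c] AX by blast
      have "f (e, Q) = w (e, P)" if "Q \<in> sides_over e" for Q
      proof -
        have "(e, Q) \<in> X" "cell_dim (e, Q) = 0" using side_cell[OF e(1,2) that] by auto
        moreover have "cell_le (e, Q) c"
          using sides_overD[OF that] face_of_imp_subset[of Q P] by (simp add: cell_le_def e(3))
        ultimately have "(e, Q) \<in> A" using A True by (auto simp: subcomplex_def)
        then show ?thesis using sides_overD[OF that] \<open>cell_dim (e, Q) = 0\<close> by (simp add: f_def)
      qed
      then have s: "coboundary A W1 f c = (\<Sum>Q\<in>sides_over e. w (e, P))"
        using cob[OF f e(1,2)] True e(3) by simp
      show ?thesis
      proof (cases "interior_simplex P e")
        case int: True
        then show ?thesis using s w0[of e] True e sides_over_interior[OF int] by (simp add: interior_edge_def)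
      next
        case False
        obtain Q where "sides_over e = {Q}" using sides_over_boundary[OF e(1,2) False] .
        then show ?thesis using s e(3) by simp
      qed
    next
      case False
      then show ?thesis using cochainsD0[OF w False] coboundary_eq_0[OF AX False] by simp
    qed
    then have "w = coboundary A W1 f" by auto
    then show "w \<in> coboundaries A W1 1" using f by simp
  qed
qed

text \<open>
  Both sides say that \<open>f\<close> and \<open>g\<close> differ by a cochain that vanishes on interior edges.
\<close>

lemma cohomologous_W1:
  assumes A: "subcomplex A"
  shows "(f, g) \<in> cohomologous A W1 1 \<longleftrightarrow> f \<in> cochains A W1 1 \<and> g \<in> wave_class A (\<lambda>e. f (e, P))"
proof -
  have AX: "A \<subseteq> X" using A by (simp add: subcomplex_def)
  have diff: "f - g \<in> cochains A W1 1" if fg: "f \<in> cochains A W1 1" "g \<in> cochains A W1 1"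
  proof (rule cochainsI)
    fix c assume c: "c \<in> A" "cell_dim c = 1"
    show "(f - g) c \<in> stalk W1 c"
      using cochainsD[OF fg(1) c] cochainsD[OF fg(2) c] by (simp add: W1_stalk_add)
  next
    fix c assume "\<not> (c \<in> A \<and> cell_dim c = 1)"
    then show "(f - g) c = 0" using cochainsD0[OF fg(1)] cochainsD0[OF fg(2)] by simp
  qed
  have "f \<in> cochains A W1 1 \<Longrightarrow> g \<in> cochains A W1 1 \<Longrightarrow>
    f - g \<in> wave_class A (\<lambda>_. 0) \<longleftrightarrow> g \<in> wave_class A (\<lambda>e. f (e, P))"
    using diff unfolding wave_class_def by (auto simp: bit2_add_eq_0_iff)
  moreover have "g \<in> wave_class A h \<Longrightarrow> g \<in> cochains A W1 1" for h by (simp add: wave_class_def)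
  ultimately show ?thesis
    unfolding cohomologous_def cocycles_W1[OF AX] coboundaries_W1[OF A] by auto
qed

lemma coh_class_W1:
  assumes "subcomplex A" "f \<in> cochains A W1 1"
  shows "coh_class A W1 1 f = wave_class A (\<lambda>e. f (e, P))"
  unfolding coh_class_def Image_singleton cohomologous_W1[OF assms(1)] using assms(2) by auto

lemma wave_class_in_cohomology:
  assumes A: "subcomplex A" and h: "wave_values h"
  shows "wave_class A h \<in> cohomology A W1 1"
proof -
  have AX: "A \<subseteq> X" using A by (simp add: subcomplex_def)
  obtain w where w: "w \<in> wave_class A h" using wave_class_nonempty[OF AX h] by blast
  then have "w \<in> cochains A W1 1" by (simp add: wave_class_def)
  moreover from w have "wave_class A h = wave_class A (\<lambda>e. w (e, P))" by (auto simp: wave_class_def)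
  ultimately have "wave_class A h = cohomologous A W1 1 `` {w}"
    using coh_class_W1[OF A] by (simp add: coh_class_def)
  moreover have "w \<in> cocycles A W1 1" using \<open>w \<in> cochains A W1 1\<close> unfolding cocycles_W1[OF AX] .
  ultimately show ?thesis unfolding cohomology_def by (auto intro: quotientI)
qed

lemma restrict_coh_wave_class:
  assumes A: "subcomplex A" and B: "subcomplex B" and AB: "A \<subseteq> B" and h: "wave_values h"
  shows "restrict_coh A W1 1 (wave_class B h) = wave_class A h"
proof -
  have BX: "B \<subseteq> X" using B by (simp add: subcomplex_def)
  have restr: "(\<lambda>c. if c \<in> A then w c else 0) \<in> wave_class A h" if "w \<in> wave_class B h" for w
  proof -
    have w: "w \<in> cochains B W1 1" "\<And>e. interior_edge e \<Longrightarrow> (e, P) \<in> B \<Longrightarrow> w (e, P) = h e"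
      using that by (auto simp: wave_class_def)
    have "(\<lambda>c. if c \<in> A then w c else 0) \<in> cochains A W1 1"
    proof (rule cochainsI)
      fix c assume c: "c \<in> A" "cell_dim c = 1"
      have "w c \<in> stalk W1 c" using AB c by (intro cochainsD[OF w(1)]) auto
      then show "(if c \<in> A then w c else 0) \<in> stalk W1 c" using c by simp
    next
      fix c assume "\<not> (c \<in> A \<and> cell_dim c = 1)"
      then show "(if c \<in> A then w c else 0) = 0" using cochainsD0[OF w(1), of c] by auto
    qed
    then show ?thesis using w(2) AB by (auto simp: wave_class_def)
  qed
  have same: "wave_class A (\<lambda>e. f (e, P)) = wave_class A h" if "f \<in> wave_class A h" for f
    using that by (auto simp: wave_class_def)
  have "g \<in> restrict_coh A W1 1 (wave_class B h) \<longleftrightarrow> g \<in> wave_class A h" for g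
  proof -
    have "g \<in> restrict_coh A W1 1 (wave_class B h) \<longleftrightarrow>
      (\<exists>w\<in>wave_class B h. ((\<lambda>c. if c \<in> A then w c else 0), g) \<in> cohomologous A W1 1)"
      by (auto simp: restrict_coh_def)
    also have "\<dots> \<longleftrightarrow> (\<exists>w\<in>wave_class B h. g \<in> wave_class A h)"
    proof (rule bex_cong[OF refl])
      fix w assume w: "w \<in> wave_class B h"
      let ?f = "\<lambda>c. if c \<in> A then w c else 0"
      have "?f \<in> cochains A W1 1" using restr[OF w] by (simp add: wave_class_def)
      then show "(?f, g) \<in> cohomologous A W1 1 \<longleftrightarrow> g \<in> wave_class A h"
        unfolding cohomologous_W1[OF A] same[OF restr[OF w]] by simp
    qed
    also have "\<dots> \<longleftrightarrow> g \<in> wave_class A h" using wave_class_nonempty[OF BX h] by blast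
    finally show ?thesis .
  qed
  then show ?thesis by blast
qed

section \<open>Gradients\<close>

lemma edges_iff: "\<sigma> \<in> K \<Longrightarrow> e \<in> edges \<sigma> \<longleftrightarrow> e \<in> K \<and> aff_dim e = 1 \<and> e \<subseteq> \<sigma>"
  using face_in_K[of \<sigma> e] subset_imp_face_of[of e \<sigma>] face_of_imp_subset[of e \<sigma>]
  unfolding edges_def by blast

lemma edges_edge:
  assumes e: "e \<in> K" "aff_dim e = 1" shows "edges e = {e}"
proof -
  have "e' = e" if "e' face_of e" "aff_dim e' = 1" for e'
    using face_of_aff_dim_lt[OF convex_K[OF e(1)] that(1)] that(2) e(2) by auto
  then show ?thesis using e convex_K[OF e(1)] by (auto simp: edges_def face_of_refl)
qed

lemma edges_triangle:
  assumes \<tau>: "\<tau> \<in> K" "aff_dim \<tau> = 2" "verts \<tau> = {a, b, c}"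
  shows "edges \<tau> = {convex hull {a, b}, convex hull {a, c}, convex hull {b, c}}"
proof -
  have h: "\<tau> = convex hull {a, b, c}" using simplex_hull(3)[OF \<tau>(1)] unfolding \<tau>(3) .
  have ind: "\<not> affine_dependent {a, b, c}" using simplex_hull(1)[OF \<tau>(1)] unfolding \<tau>(3) .
  have ne: "a \<noteq> b" "a \<noteq> c" "b \<noteq> c" using red2_distinct_triangle[OF \<tau>] by auto
  have "convex hull {p, q} \<in> edges \<tau>" if "{p, q} \<subseteq> {a, b, c}" "p \<noteq> q" for p q
  proof -
    have "convex hull {p, q} face_of \<tau>"
      unfolding h face_of_convex_hull_affine_independent[OF ind] using that by blast
    moreover have "aff_dim (convex hull {p, q}) = 1"
      using that aff_dim_hull[of "{p, q}"] by simp
    ultimately show ?thesis by (simp add: edges_def)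
  qed
  moreover have "e \<in> {convex hull {a, b}, convex hull {a, c}, convex hull {b, c}}" if "e \<in> edges \<tau>" for e
  proof -
    have e: "e \<in> K" "aff_dim e = 1" "e \<subseteq> \<tau>" using that edges_iff[OF \<tau>(1)] by auto
    obtain p q where pq: "p \<noteq> q" "verts e = {p, q}" "e = convex hull {p, q}" using edge_verts[OF e(1,2)] .
    have "{p, q} \<subseteq> {a, b, c}" using verts_mono[OF e(1) \<tau>(1) e(3)] pq(2) \<tau>(3) by simp
    then have "{p, q} = {a, b} \<or> {p, q} = {a, c} \<or> {p, q} = {b, c}" using pq(1) by auto
    then show ?thesis unfolding pq(3) by auto
  qed
  ultimately show ?thesis using ne by blast
qed

lemma verts_hull_2: "verts (convex hull {a, b}) = {a, b}"
  by (rule verts_hull) simp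

lemma sum_verts_edge: "p \<noteq> q \<Longrightarrow> (\<Sum>v\<in>verts (convex hull {p, q}). f v) = f p + f q"
  by (simp add: verts_hull_2)

text \<open>
  Each vertex of a triangle lies on two of its edges.
\<close>

lemma sum_edges_triangle:
  fixes f :: "real ^ 2 \<Rightarrow> bit"
  assumes \<tau>: "\<tau> \<in> K" "aff_dim \<tau> = 2"
  shows "(\<Sum>e\<in>edges \<tau>. \<Sum>v\<in>verts e. f v) = 0"
proof -
  obtain a b c where v: "verts \<tau> = {a, b, c}" "\<tau> = convex hull {a, b, c}" "a \<noteq> b" "a \<noteq> c" "b \<noteq> c"
    using triangle_verts[OF \<tau>] .
  have "convex hull {a, b} \<noteq> convex hull {a, c}" "convex hull {a, b} \<noteq> convex hull {b, c}"
    "convex hull {a, c} \<noteq> convex hull {b, c}"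
    using v(3-5) verts_hull_2[of a b] verts_hull_2[of a c] verts_hull_2[of b c]
    by (metis doubleton_eq_iff)+
  then have "(\<Sum>e\<in>edges \<tau>. \<Sum>v\<in>verts e. f v) = (f a + f b) + ((f a + f c) + (f b + f c))"
    unfolding edges_triangle[OF \<tau> v(1)] using v(3-5) by (simp add: sum_verts_edge)
  also have "\<dots> = 0" by (cases "f a"; cases "f b"; cases "f c") simp_all
  finally show ?thesis .
qed

lemma simp_d0_triangle_eq_iff:
  assumes \<tau>: "\<tau> \<in> K" "aff_dim \<tau> = 2" "verts \<tau> = {a, b, c}"
  shows "simp_d0 \<tau> f = simp_d0 \<tau> g \<longleftrightarrow> f a + f b = g a + g b \<and> f a + f c = g a + g c"
proof -
  have ne: "a \<noteq> b" "a \<noteq> c" "b \<noteq> c" using red2_distinct_triangle[OF \<tau>] by auto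
  have "simp_d0 \<tau> f = simp_d0 \<tau> g \<longleftrightarrow> (\<forall>e\<in>edges \<tau>. (\<Sum>v\<in>verts e. f v) = (\<Sum>v\<in>verts e. g v))"
    by (auto simp: simp_d0_def fun_eq_iff)
  also have "\<dots> \<longleftrightarrow> f a + f b = g a + g b \<and> f a + f c = g a + g c \<and> f b + f c = g b + g c"
    unfolding edges_triangle[OF \<tau>] using ne by (simp add: sum_verts_edge)
  also have "\<dots> \<longleftrightarrow> f a + f b = g a + g b \<and> f a + f c = g a + g c"
    by (cases "f a"; cases "f b"; cases "f c"; cases "g a"; cases "g b"; cases "g c") simp_all
  finally show ?thesis .
qed

lemma simp_d0_edge_eq_iff:
  assumes e: "e \<in> K" "aff_dim e = 1" "verts e = {a, b}" "a \<noteq> b"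
  shows "simp_d0 e f = simp_d0 e g \<longleftrightarrow> f a + f b = g a + g b"
  using e(3,4) edges_edge[OF e(1,2)] by (auto simp: simp_d0_def fun_eq_iff)

text \<open>
  The unique linear form modulo 2 with the same differences as \<open>\<epsilon>\<close> on the vertices of the triangle.
\<close>

definition gradient :: "(real ^ 2 \<Rightarrow> bit) \<Rightarrow> (real ^ 2) set \<Rightarrow> bit ^ 2" where
  "gradient \<epsilon> \<tau> = (SOME u. zmap (\<tau>, P) u = simp_d0 \<tau> \<epsilon>)"

lemma zmap_triangle_iff:
  assumes \<tau>: "\<tau> \<in> K" "aff_dim \<tau> = 2" "verts \<tau> = {a, b, c}"
  shows "zmap (\<tau>, Q) u = simp_d0 \<tau> \<epsilon> \<longleftrightarrow>
    pair2 (red2 a + red2 b) u = \<epsilon> a + \<epsilon> b \<and> pair2 (red2 a + red2 c) u = \<epsilon> a + \<epsilon> c"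
  by (simp add: zmap_def simp_d0_triangle_eq_iff[OF \<tau>] pair2_add_left)

lemma zmap_edge_iff:
  assumes e: "e \<in> K" "aff_dim e = 1" "verts e = {a, b}" "a \<noteq> b"
  shows "zmap (e, Q) u = simp_d0 e \<epsilon> \<longleftrightarrow> pair2 (red2 a + red2 b) u = \<epsilon> a + \<epsilon> b"
  by (simp add: zmap_def simp_d0_edge_eq_iff[OF e] pair2_add_left)

lemma gradient_eq_iff:
  assumes \<tau>: "\<tau> \<in> K" "aff_dim \<tau> = 2"
  shows "zmap (\<tau>, Q) u = simp_d0 \<tau> \<epsilon> \<longleftrightarrow> u = gradient \<epsilon> \<tau>"
proof -
  obtain a b c where v: "verts \<tau> = {a, b, c}" using triangle_verts[OF \<tau>] .
  note iff = zmap_triangle_iff[OF \<tau> v]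
  note distinct = red2_distinct_triangle[OF \<tau> v]
  obtain u0 where "pair2 (red2 a + red2 b) u0 = \<epsilon> a + \<epsilon> b" "pair2 (red2 a + red2 c) u0 = \<epsilon> a + \<epsilon> c"
    using gradient_exists[OF distinct] .
  then have "zmap (\<tau>, P) u0 = simp_d0 \<tau> \<epsilon>" unfolding iff by simp
  then have g: "zmap (\<tau>, P) (gradient \<epsilon> \<tau>) = simp_d0 \<tau> \<epsilon>"
    unfolding gradient_def by (rule someI)
  show ?thesis
  proof
    assume "zmap (\<tau>, Q) u = simp_d0 \<tau> \<epsilon>"
    then show "u = gradient \<epsilon> \<tau>" using g gradient_unique[OF distinct] unfolding iff by simp
  next
    assume "u = gradient \<epsilon> \<tau>"
    then show "zmap (\<tau>, Q) u = simp_d0 \<tau> \<epsilon>" using g unfolding iff by simp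
  qed
qed

lemma gradient_triangle:
  assumes \<tau>: "\<tau> \<in> K" "aff_dim \<tau> = 2" "verts \<tau> = {a, b, c}"
  shows "pair2 (red2 a + red2 b) (gradient \<epsilon> \<tau>) = \<epsilon> a + \<epsilon> b"
    "pair2 (red2 a + red2 c) (gradient \<epsilon> \<tau>) = \<epsilon> a + \<epsilon> c"
  using gradient_eq_iff[OF \<tau>(1,2), of P "gradient \<epsilon> \<tau>" \<epsilon>] unfolding zmap_triangle_iff[OF \<tau>] by auto

section \<open>The Hessian\<close>

text \<open>
  The change of the gradient across an interior edge; for a boundary edge the sum has one term.
\<close>

definition edge_hessian :: "(real ^ 2 \<Rightarrow> bit) \<Rightarrow> (real ^ 2) set \<Rightarrow> bit ^ 2" where
  "edge_hessian \<epsilon> e = (\<Sum>\<tau>\<in>adjacent_triangles e. gradient \<epsilon> \<tau>)"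

lemma edge_hessian_hinge:
  assumes h: "hinge e a b c1 c2 \<tau>1 \<tau>2"
  shows "edge_hessian \<epsilon> e = edge_jump (red2 c1) (red2 c2) (\<epsilon> a) (\<epsilon> b) (\<epsilon> c1) (\<epsilon> c2) *s W1_generator e"
proof -
  have "edge_hessian \<epsilon> e = gradient \<epsilon> \<tau>1 + gradient \<epsilon> \<tau>2"
    using hingeD(4,5)[OF h] by (simp add: edge_hessian_def)
  also have "\<dots> = edge_jump (red2 c1) (red2 c2) (\<epsilon> a) (\<epsilon> b) (\<epsilon> c1) (\<epsilon> c2) *s quarter_turn2 (red2 a + red2 b)"
    by (rule gradient_jump)
      (rule hinge_red2[OF h] gradient_triangle[OF hingeD(11,12,6)[OF h]]
        gradient_triangle[OF hingeD(13,14,7)[OF h]])+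
  finally show ?thesis unfolding W1_generator_edge[OF hingeD(1-3)[OF h]] .
qed

lemma scale_W1_generator:
  assumes e: "e \<in> K" "verts e = {a, b}" "a \<noteq> b" shows "x *s W1_generator e \<in> W1_stalk e"
  unfolding W1_generator_edge[OF e] W1_stalk_edge[OF e] by (cases x) simp_all

lemma wave_values_edge_hessian: "wave_values (edge_hessian \<epsilon>)"
  unfolding wave_values_def
proof (intro allI impI)
  fix e assume "interior_edge e"
  then have e: "e \<in> K" "aff_dim e = 1" "interior_simplex P e" by (auto simp: interior_edge_def)
  obtain a b where ab: "a \<noteq> b" "verts e = {a, b}" "e = convex hull {a, b}" using edge_verts[OF e(1,2)] .
  obtain c1 c2 \<tau>1 \<tau>2 where h: "hinge e a b c1 c2 \<tau>1 \<tau>2"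
    using interior_edge_hinge[OF e(1) ab(2,1) e(3)] .
  show "edge_hessian \<epsilon> e \<in> W1_stalk e"
    unfolding edge_hessian_hinge[OF h] by (rule scale_W1_generator[OF hingeD(1-3)[OF h]])
qed

lemma cells_below_card:
  assumes e: "e \<in> K" "aff_dim e = 1"
  shows "card {c' \<in> X. cell_le c' (e, P) \<and> cell_dim (e, P) = Suc (cell_dim c')} = 2"
proof -
  have "(\<lambda>\<tau>. (\<tau>, P)) ` adjacent_triangles e \<inter> (\<lambda>Q. (e, Q)) ` sides_over e = {}"
    by (auto dest: sides_overD)
  then show ?thesis
    unfolding cells_below[OF e] using two_sided[OF e]
    by (subst card_Un_disjoint) (auto simp: card_image inj_on_def)
qed

text \<open>
  The endpoints of \<open>e\<^sup>*\<close> are two simplices containing \<open>e\<close>, and the section restricts to the same cocycle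
  on \<open>e\<close> from both.
\<close>

lemma d_section_cocycle: "d_section X \<epsilon> \<in> cocycles X Z1_sheaf 0"
proof -
  have "d_section X \<epsilon> \<in> cochains X Z1_sheaf 0"
  proof (rule cochainsI)
    fix c assume c: "c \<in> X" "cell_dim c = 0"
    have \<sigma>: "fst c \<in> K" using c by (auto simp: Xcells_def Ycells_def)
    have "(\<Sum>e\<in>edges t. simp_d0 (fst c) \<epsilon> e) = 0" if t: "t face_of fst c" "aff_dim t = 2" for t
    proof -
      have "edges t \<subseteq> edges (fst c)" using t(1) face_of_trans by (auto simp: edges_def)
      then have "(\<Sum>e\<in>edges t. simp_d0 (fst c) \<epsilon> e) = (\<Sum>e\<in>edges t. \<Sum>v\<in>verts e. \<epsilon> v)"
        by (intro sum.cong refl) (auto simp: simp_d0_def)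
      then show ?thesis using sum_edges_triangle[OF face_in_K[OF \<sigma> t(1)] t(2)] by simp
    qed
    then show "d_section X \<epsilon> c \<in> stalk Z1_sheaf c"
      using c by (simp add: d_section_def Z1_sheaf_def simp_Z1_def) (simp add: simp_d0_def)
  qed (auto simp: d_section_def)
  moreover have "coboundary X Z1_sheaf (d_section X \<epsilon>) c = 0" for c
  proof (cases "c \<in> X \<and> cell_dim c = 1")
    case True
    then obtain e where e: "e \<in> K" "aff_dim e = 1" "c = (e, P)" using cell_dim_1_cases by blast
    define B where "B = {c' \<in> X. cell_le c' (e, P) \<and> cell_dim (e, P) = Suc (cell_dim c')}"
    define k where "k = (\<lambda>e'. if e' \<in> edges e then \<Sum>v\<in>verts e'. \<epsilon> v else 0)"
    have "res Z1_sheaf c' (e, P) (d_section X \<epsilon> c') = k" if "c' \<in> B" for c'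
    proof -
      have c': "c' \<in> X" "e \<subseteq> fst c'" "cell_dim c' = 0"
        using that dual_edge_cell[OF e(1,2)] by (auto simp: B_def cell_le_def)
      have "fst c' \<in> K" using c' by (auto simp: Xcells_def Ycells_def)
      then have "e \<in> edges (fst c')" using edges_iff e c' by blast
      then show ?thesis
        using c' edges_edge[OF e(1,2)] by (auto simp: Z1_sheaf_def d_section_def simp_d0_def k_def)
    qed
    then have "coboundary X Z1_sheaf (d_section X \<epsilon>) c = (\<Sum>c'\<in>B. k)"
      using True unfolding coboundary_def B_def e(3) by simp
    also obtain p q where "B = {p, q}" "p \<noteq> q"
      using cells_below_card[OF e(1,2)] by (auto simp: B_def card_2_iff)
    then have "(\<Sum>c'\<in>B. k) = k + k" by simp
    also have "k + k = 0" by (simp add: fun_eq_iff)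
    finally show ?thesis .
  qed (use coboundary_eq_0 in blast)
  ultimately show ?thesis by (auto simp: cocycles_def fun_eq_iff)
qed

lemma coh_class_d_section: "coh_class X Z1_sheaf 0 (d_section X \<epsilon>) = {d_section X \<epsilon>}"
  using d_section_cocycle[of \<epsilon>] by (auto simp: coh_class_def cohomologous_def)

lemma N2_simps [simp]: "stalk N2_sheaf c = UNIV" "res N2_sheaf c' c u = u"
  by (simp_all add: N2_sheaf_def)

text \<open>
  The connecting morphism lifts the section \<open>d\<epsilon>\<close> to \<open>N\<^sub>2\<close> at the vertices of \<open>X\<close>. At a triangle the only
  lift is the gradient, which fixes the coboundary on interior edges. At a vertex \<open>[e,Q]\<close> the lifts
  form a coset of the stalk at \<open>e\<close>, so the value on a boundary edge can be chosen at will.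
\<close>

lemma hessian_eq: "hessian K P \<epsilon> = wave_class X (edge_hessian \<epsilon>)"
proof (intro equalityI subsetI)
  fix w assume "w \<in> hessian K P \<epsilon>"
  then obtain f where w: "w \<in> cocycles X W1 (Suc 0)" and f: "f \<in> cochains X N2_sheaf 0"
    and z: "\<And>c. c \<in> X \<Longrightarrow> cell_dim c = 0 \<Longrightarrow> zmap c (f c) = d_section X \<epsilon> c"
    and eq: "w = coboundary X N2_sheaf f"
    unfolding hessian_def connecting_def coh_class_d_section by blast
  have "w (e, P) = edge_hessian \<epsilon> e" if "interior_edge e" for e
  proof -
    have e: "e \<in> K" "aff_dim e = 1" "interior_simplex P e" using that by (auto simp: interior_edge_def)
    have "f (\<tau>, P) = gradient \<epsilon> \<tau>" if "\<tau> \<in> adjacent_triangles e" for \<tau>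
    proof -
      have \<tau>: "\<tau> \<in> K" "aff_dim \<tau> = 2" using adjacentD[OF that] by auto
      have "zmap (\<tau>, P) (f (\<tau>, P)) = simp_d0 \<tau> \<epsilon>"
        using z[of "(\<tau>, P)"] triangle_cell[OF \<tau>] by (simp add: d_section_def)
      then show ?thesis using gradient_eq_iff[OF \<tau>] by blast
    qed
    then show ?thesis
      using dual_edge_cell[OF e(1,2)] sides_over_interior[OF e(3)]
      by (simp add: eq coboundary_dual_edge[OF subcomplex_X e(1,2)] edge_hessian_def)
  qed
  moreover have "w \<in> cochains X W1 1" using w cocycles_W1[of X] by simp
  ultimately show "w \<in> wave_class X (edge_hessian \<epsilon>)" by (simp add: wave_class_def)
next
  fix w assume "w \<in> wave_class X (edge_hessian \<epsilon>)"
  then have w: "w \<in> cochains X W1 1"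
    and wh: "\<And>e. interior_edge e \<Longrightarrow> (e, P) \<in> X \<Longrightarrow> w (e, P) = edge_hessian \<epsilon> e"
    by (auto simp: wave_class_def)
  \<comment> \<open>At \<open>[e,Q]\<close> the gradient of the adjacent triangle is corrected by the prescribed value on \<open>e\<^sup>*\<close>.\<close>
  define f where "f c = (if c \<in> X \<and> cell_dim c = 0
    then if snd c = P then gradient \<epsilon> (fst c) else w (fst c, P) + edge_hessian \<epsilon> (fst c) else 0)" for c
  have f_triangle: "f (\<tau>, P) = gradient \<epsilon> \<tau>" if "\<tau> \<in> K" "aff_dim \<tau> = 2" for \<tau>
    using triangle_cell[OF that] by (simp add: f_def)
  have f_side: "f (e, Q) = w (e, P) + edge_hessian \<epsilon> e" if "e \<in> K" "aff_dim e = 1" "Q \<in> sides_over e" for e Q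
    using side_cell[OF that] sides_overD[OF that(3)] by (simp add: f_def)
  have z: "zmap c (f c) = d_section X \<epsilon> c" if c: "c \<in> X" "cell_dim c = 0" for c
    using c(1)
  proof (cases rule: Xcells_cases)
    case (triangle \<tau>)
    then show ?thesis
      using c gradient_eq_iff[OF triangle(1,2)] f_triangle[OF triangle(1,2)] by (simp add: d_section_def)
  next
    case (dual_edge e)
    then show ?thesis using c dual_edge_cell[of e] by simp
  next
    case (side e Q)
    obtain a b where ab: "a \<noteq> b" "verts e = {a, b}" "e = convex hull {a, b}" using edge_verts[OF side(1,2)] .
    have "\<not> interior_simplex P e" using sides_over_interior side(3) by blast
    then obtain \<tau> where adj: "adjacent_triangles e = {\<tau>}" using adjacent_triangles_boundary[OF side(1,2)] by blast
    then have \<tau>: "\<tau> \<in> K" "aff_dim \<tau> = 2" "e \<subseteq> \<tau>" using adjacentD[of \<tau> e] by auto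
    obtain v where v: "verts \<tau> = {a, b, v}" using triangle_over_edge[OF \<tau>(1,2) side(1) \<tau>(3) ab(2,1)] .
    have "w (e, P) \<in> W1_stalk e"
      using cochainsD[OF w, of "(e, P)"] dual_edge_cell[OF side(1,2)] by simp
    then have "pair2 (red2 a + red2 b) (w (e, P)) = 0" using W1_stalk_orthogonal side(1) ab(2) by blast
    moreover have "f (e, Q) = w (e, P) + gradient \<epsilon> \<tau>"
      using f_side[OF side(1-3)] adj by (simp add: edge_hessian_def)
    ultimately have "pair2 (red2 a + red2 b) (f (e, Q)) = \<epsilon> a + \<epsilon> b"
      using gradient_triangle(1)[OF \<tau>(1,2) v] by (simp add: pair2_add_right)
    then have "zmap (e, Q) (f (e, Q)) = simp_d0 e \<epsilon>"
      using zmap_edge_iff[OF side(1,2) ab(2,1)] by blast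
    then show ?thesis using c side(4) by (simp add: d_section_def)
  qed
  have "coboundary X N2_sheaf f c = w c" for c
  proof (cases "c \<in> X \<and> cell_dim c = 1")
    case True
    then obtain e where e: "e \<in> K" "aff_dim e = 1" "c = (e, P)" using cell_dim_1_cases by blast
    have "(\<Sum>\<tau>\<in>adjacent_triangles e. f (\<tau>, P)) = edge_hessian \<epsilon> e"
      unfolding edge_hessian_def by (intro sum.cong refl f_triangle) (auto dest: adjacentD)
    moreover have "(\<Sum>Q\<in>sides_over e. f (e, Q)) = (\<Sum>Q\<in>sides_over e. w (e, P) + edge_hessian \<epsilon> e)"
      by (intro sum.cong refl f_side e)
    ultimately have cob: "coboundary X N2_sheaf f c
        = edge_hessian \<epsilon> e + (\<Sum>Q\<in>sides_over e. w (e, P) + edge_hessian \<epsilon> e)"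
      using True e coboundary_dual_edge[OF subcomplex_X e(1,2), of N2_sheaf f] by simp
    show ?thesis
    proof (cases "interior_simplex P e")
      case int: True
      then show ?thesis
        using cob sides_over_interior[OF int] wh[of e] True e by (simp add: interior_edge_def)
    next
      case False
      obtain Q where "sides_over e = {Q}" using sides_over_boundary[OF e(1,2) False] .
      then show ?thesis using cob e(3) by (simp add: ac_simps)
    qed
  next
    case False
    then show ?thesis using cochainsD0[OF w False] coboundary_eq_0[of X c] by simp
  qed
  then have "w = coboundary X N2_sheaf f" by auto
  moreover have "f \<in> cochains X N2_sheaf 0" by (rule cochainsI) (auto simp: f_def)
  moreover have "w \<in> cocycles X W1 (Suc 0)" using w cocycles_W1[of X] by simp
  ultimately show "w \<in> hessian K P \<epsilon>"
    unfolding hessian_def connecting_def coh_class_d_section using z by blast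
qed

section \<open>The canonical wave\<close>

text \<open>
  The value on \<open>e\<^sup>*\<close>, for an interior edge \<open>e\<close>, of the cochain that defines the canonical wave.
\<close>

definition edge_wave :: "(real ^ 2) set \<Rightarrow> bit ^ 2" where
  "edge_wave e = edge_rho K e (SOME v. v \<in> verts e) *s W1_generator e"

text \<open>
  As \<open>a\<close> and \<open>b\<close> carry the same coefficient \<open>x\<close>, the defining condition is \<open>c1 + c2 = x (a + b)\<close> modulo 2,
  which has the parity as its only solution because \<open>a + b \<noteq> 0\<close>.
\<close>

lemma edge_rho_hinge:
  assumes h: "hinge e a b c1 c2 \<tau>1 \<tau>2" and v: "v \<in> verts e"
  shows "edge_rho K e v = edge_parity (red2 c1) (red2 c2)"
proof -
  note e = hingeD(1-3)[OF h] and adj = hingeD(4,6-10)[OF h] and d = hinge_red2[OF h]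
  have "opposite K e = (\<Union>\<tau>\<in>adjacent_triangles e. verts \<tau> - verts e)"
    unfolding opposite_def adjacent_triangles_def
    using subset_imp_face_of[OF e(1)] face_of_imp_subset by blast
  also have "\<dots> = {c1, c2}" unfolding adj(1) e(2) using adj(2-5) by auto
  finally have opp: "opposite K e = {c1, c2}" .
  have sum: "red2 c1 + red2 c2 = edge_parity (red2 c1) (red2 c2) *s (red2 a + red2 b)"
  proof (cases "red2 c1 = red2 c2")
    case False
    then have "red2 c2 = red2 a + red2 b + red2 c1" using fourth_point2[OF d] by simp
    then show ?thesis using False by (simp add: edge_parity_def ac_simps)
  qed (simp add: edge_parity_def)
  have "red2 a + red2 b \<noteq> 0" using d(1) by (simp add: bit2_add_eq_0_iff)
  then have cancel: "x *s (red2 a + red2 b) = y *s (red2 a + red2 b) \<longleftrightarrow> x = y" for x y :: bit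
    unfolding vector_mul_rcancel by simp
  define R where "R v = (if v \<in> verts e then edge_parity (red2 c1) (red2 c2) else 0)" for v
  have "edge_rho K e = R"
    unfolding edge_rho_def
  proof (rule the_equality, intro conjI)
    show "\<forall>v. v \<notin> verts e \<longrightarrow> R v = 0" by (simp add: R_def)
    show "(\<Sum>v\<in>verts e. R v) = 0" using e by (simp add: R_def)
    show "\<exists>v1 v2. v1 \<noteq> v2 \<and> opposite K e = {v1, v2} \<and> (\<Sum>v\<in>verts e. R v *s red2 v) = red2 v1 - red2 v2"
      using e opp adj(6) sum by (intro exI[of _ c1] exI[of _ c2]) (simp add: R_def vector_add_ldistrib)
  next
    fix r assume r: "(\<forall>v. v \<notin> verts e \<longrightarrow> r v = 0) \<and> (\<Sum>v\<in>verts e. r v) = 0 \<and>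
      (\<exists>v1 v2. v1 \<noteq> v2 \<and> opposite K e = {v1, v2} \<and> (\<Sum>v\<in>verts e. r v *s red2 v) = red2 v1 - red2 v2)"
    then obtain v1 v2 where v12: "opposite K e = {v1, v2}"
      "(\<Sum>v\<in>verts e. r v *s red2 v) = red2 v1 - red2 v2" by blast
    have rab: "r a = r b" using r e by simp
    have "red2 v1 + red2 v2 = red2 c1 + red2 c2"
      using v12(1) opp by (auto simp: doubleton_eq_iff add.commute)
    then have "r a *s (red2 a + red2 b) = edge_parity (red2 c1) (red2 c2) *s (red2 a + red2 b)"
      using v12(2) e rab by (simp add: vector_add_ldistrib sum)
    then have "r a = edge_parity (red2 c1) (red2 c2)" using cancel by blast
    then show "r = R" using r rab e by (auto simp: R_def)
  qed
  then show ?thesis using v by (simp add: R_def)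
qed

lemma edge_wave_hinge:
  assumes h: "hinge e a b c1 c2 \<tau>1 \<tau>2"
  shows "edge_wave e = edge_parity (red2 c1) (red2 c2) *s W1_generator e"
proof -
  have "(SOME v. v \<in> verts e) \<in> verts e" by (rule someI[of _ a]) (simp add: hingeD[OF h])
  then show ?thesis using edge_rho_hinge[OF h] by (simp add: edge_wave_def)
qed

lemma wave_values_edge_wave: "wave_values edge_wave"
  unfolding wave_values_def
proof (intro allI impI)
  fix e assume "interior_edge e"
  then have e: "e \<in> K" "aff_dim e = 1" by (auto simp: interior_edge_def)
  obtain a b where ab: "a \<noteq> b" "verts e = {a, b}" "e = convex hull {a, b}" using edge_verts[OF e] .
  show "edge_wave e \<in> W1_stalk e"
    unfolding edge_wave_def by (rule scale_W1_generator[OF e(1) ab(2,1)])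
qed

lemma rho_tilde_eq: "rho_tilde K P = wave_class X edge_wave"
proof -
  have rho: "rho_cochain K P = (\<lambda>c. if c \<in> X \<and> interior_edge (fst c) \<and> snd c = P then edge_wave (fst c) else 0)"
    using dual_edge_cell
    by (fastforce simp: fun_eq_iff rho_cochain_def star_cell_def interior_edge_def edge_wave_def)
  have w: "rho_cochain K P \<in> wave_class X edge_wave"
    unfolding rho by (rule wave_class_nonempty[OF _ wave_values_edge_wave]) simp
  then have "rho_cochain K P \<in> cochains X W1 1" by (simp add: wave_class_def)
  then have "rho_tilde K P = wave_class X (\<lambda>e. rho_cochain K P (e, P))"
    unfolding rho_tilde_def by (rule coh_class_W1[OF subcomplex_X])
  also have "\<dots> = wave_class X edge_wave" using w by (auto simp: wave_class_def)
  finally show ?thesis .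
qed

text \<open>
  On an interior edge the Hessian and the canonical wave are multiples of the same generator, so they
  agree iff the factors do.
\<close>

lemma edge_equation:
  assumes "interior_edge e"
  obtains a b c1 c2 \<tau>1 \<tau>2 where "hinge e a b c1 c2 \<tau>1 \<tau>2"
    and "\<And>\<epsilon>. edge_hessian \<epsilon> e = edge_wave e \<longleftrightarrow>
      edge_jump (red2 c1) (red2 c2) (\<epsilon> a) (\<epsilon> b) (\<epsilon> c1) (\<epsilon> c2) = edge_parity (red2 c1) (red2 c2)"
proof -
  have e: "e \<in> K" "aff_dim e = 1" "interior_simplex P e" using assms by (auto simp: interior_edge_def)
  obtain a b where ab: "a \<noteq> b" "verts e = {a, b}" "e = convex hull {a, b}" using edge_verts[OF e(1,2)] .
  obtain c1 c2 \<tau>1 \<tau>2 where h: "hinge e a b c1 c2 \<tau>1 \<tau>2"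
    using interior_edge_hinge[OF e(1) ab(2,1) e(3)] .
  have "edge_hessian \<epsilon> e = edge_wave e \<longleftrightarrow>
      edge_jump (red2 c1) (red2 c2) (\<epsilon> a) (\<epsilon> b) (\<epsilon> c1) (\<epsilon> c2) = edge_parity (red2 c1) (red2 c2)" for \<epsilon>
    unfolding edge_hessian_hinge[OF h] edge_wave_hinge[OF h]
    using W1_generator_edge(2)[OF hingeD(1-3)[OF h]] by simp
  with h show thesis by (rule that)
qed

lemma hessian_eq_rho_tilde_iff:
  "hessian K P \<epsilon> = rho_tilde K P \<longleftrightarrow> (\<forall>e. interior_edge e \<longrightarrow> edge_hessian \<epsilon> e = edge_wave e)"
  unfolding hessian_eq rho_tilde_eq wave_class_eq_iff[OF order_refl wave_values_edge_hessian]
  using dual_edge_cell by (auto simp: interior_edge_def)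

section \<open>Solutions of the Hessian equation\<close>

lemma restrict_to_vertices_in_C0: "restrict_to_vertices K q \<in> C0 K"
  by (simp add: C0_def restrict_to_vertices_def)

lemma restrict_to_vertices_vertex:
  "\<sigma> \<in> K \<Longrightarrow> v \<in> verts \<sigma> \<Longrightarrow> restrict_to_vertices K q v = q (red2 v)"
  by (simp add: restrict_to_vertices_def vertex_in_K)

lemma quadratic_is_solution:
  assumes q: "quadratic_function q"
  shows "hessian K P (restrict_to_vertices K q) = rho_tilde K P"
  unfolding hessian_eq_rho_tilde_iff
proof (intro allI impI)
  fix e assume "interior_edge e"
  then obtain a b c1 c2 \<tau>1 \<tau>2 where h: "hinge e a b c1 c2 \<tau>1 \<tau>2"
    and iff: "\<And>\<epsilon>. edge_hessian \<epsilon> e = edge_wave e \<longleftrightarrow>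
      edge_jump (red2 c1) (red2 c2) (\<epsilon> a) (\<epsilon> b) (\<epsilon> c1) (\<epsilon> c2) = edge_parity (red2 c1) (red2 c2)"
    using edge_equation by metis
  have val: "restrict_to_vertices K q v = q (red2 v)" if "v \<in> {a, b, c1, c2}" for v
    using that hingeD(6,7)[OF h] restrict_to_vertices_vertex[OF hingeD(11)[OF h]]
      restrict_to_vertices_vertex[OF hingeD(13)[OF h]] by auto
  show "edge_hessian (restrict_to_vertices K q) e = edge_wave e"
    unfolding iff using quadratic_function_jump[OF q hinge_red2[OF h]] by (simp add: val)
qed

lemma triangle_exists: obtains \<tau> where "\<tau> \<in> K" "aff_dim \<tau> = 2"
proof -
  have "P \<noteq> {}" using aff_dim_P by auto
  then obtain \<sigma> where "\<sigma> \<in> K" using Union_K by blast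
  then show thesis using in_triangle[of \<sigma>] that by metis
qed

lemma vertex_in_triangle:
  assumes "{v} \<in> K" obtains \<tau> where "\<tau> \<in> K" "aff_dim \<tau> = 2" "v \<in> verts \<tau>"
proof -
  obtain \<tau> where \<tau>: "\<tau> \<in> K" "aff_dim \<tau> = 2" "{v} \<subseteq> \<tau>" using in_triangle[OF assms] .
  then have "v \<in> verts \<tau>"
    using subset_imp_face_of[OF assms \<tau>(1,3)] by (simp add: verts_def face_of_singleton)
  then show thesis using that \<tau> by blast
qed

text \<open>
  There is a quadratic function that agrees with \<open>\<epsilon>\<close> on the vertices of one triangle. The equation at
  an interior edge determines the value at one apex from the values at the other three vertices, and
  it holds for \<open>\<epsilon>\<close> and for the quadratic function, so their agreement propagates to all triangles.
\<close>

lemma solution_is_quadratic: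
  assumes \<epsilon>: "\<epsilon> \<in> C0 K" and sol: "hessian K P \<epsilon> = rho_tilde K P"
  obtains q where "quadratic_function q" "\<epsilon> = restrict_to_vertices K q"
proof -
  obtain \<tau>0 where \<tau>0: "\<tau>0 \<in> K" "aff_dim \<tau>0 = 2" using triangle_exists .
  obtain a0 b0 c0 where v0: "verts \<tau>0 = {a0, b0, c0}" using triangle_verts[OF \<tau>0] .
  obtain q where q: "quadratic_function q"
    "q (red2 a0) = \<epsilon> a0" "q (red2 b0) = \<epsilon> b0" "q (red2 c0) = \<epsilon> c0"
    using quadratic_function_interpolation[OF red2_distinct_triangle[OF \<tau>0 v0]] .
  define r where "r = restrict_to_vertices K q"
  have r: "hessian K P r = rho_tilde K P" unfolding r_def by (rule quadratic_is_solution[OF q(1)])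
  define S where "S = {\<tau> \<in> K. aff_dim \<tau> = 2 \<and> (\<forall>v\<in>verts \<tau>. \<epsilon> v = r v)}"
  have "S = {\<tau> \<in> K. aff_dim \<tau> = 2}"
  proof (rule triangles_connected)
    show "S \<subseteq> {\<tau> \<in> K. aff_dim \<tau> = 2}" by (auto simp: S_def)
    have "\<tau>0 \<in> S" unfolding S_def r_def using \<tau>0 v0 q restrict_to_vertices_vertex[OF \<tau>0(1)] by auto
    then show "S \<noteq> {}" by blast
    fix e \<tau> \<tau>'
    assume "e \<in> K" "aff_dim e = 1" "interior_simplex P e"
      and \<tau>S: "\<tau> \<in> S" and adj: "\<tau> \<in> adjacent_triangles e" "\<tau>' \<in> adjacent_triangles e"
    then have int: "interior_edge e" by (simp add: interior_edge_def)
    then obtain a b c1 c2 \<tau>1 \<tau>2 where h: "hinge e a b c1 c2 \<tau>1 \<tau>2"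
      and iff: "\<And>\<epsilon>. edge_hessian \<epsilon> e = edge_wave e \<longleftrightarrow>
        edge_jump (red2 c1) (red2 c2) (\<epsilon> a) (\<epsilon> b) (\<epsilon> c1) (\<epsilon> c2) = edge_parity (red2 c1) (red2 c2)"
      using edge_equation by metis
    note e = hingeD[OF h]
    have \<tau>': "\<tau>' \<in> K" "aff_dim \<tau>' = 2" using adjacentD[OF adj(2)] by auto
    have "edge_hessian \<epsilon> e = edge_wave e" "edge_hessian r e = edge_wave e"
      using sol r int unfolding hessian_eq_rho_tilde_iff by blast+
    then have eq: "edge_jump (red2 c1) (red2 c2) (\<epsilon> a) (\<epsilon> b) (\<epsilon> c1) (\<epsilon> c2)
        = edge_jump (red2 c1) (red2 c2) (r a) (r b) (r c1) (r c2)"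
      unfolding iff by simp
    have agree: "\<epsilon> v = r v" if "v \<in> verts \<tau>" for v using \<tau>S that by (simp add: S_def)
    consider "\<tau>' = \<tau>" | "\<tau> = \<tau>1" "\<tau>' = \<tau>2" | "\<tau> = \<tau>2" "\<tau>' = \<tau>1" using adj e(4) by blast
    then show "\<tau>' \<in> S"
    proof cases
      case 2
      then have "\<epsilon> a = r a" "\<epsilon> b = r b" "\<epsilon> c1 = r c1" using agree e(6) by auto
      then have "\<epsilon> c2 = r c2" using eq by (simp add: edge_jump_def)
      then show ?thesis using \<open>\<epsilon> a = r a\<close> \<open>\<epsilon> b = r b\<close> \<tau>' 2 e(7) by (simp add: S_def)
    next
      case 3
      then have "\<epsilon> a = r a" "\<epsilon> b = r b" "\<epsilon> c2 = r c2" using agree e(7) by auto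
      then have "\<epsilon> c1 = r c1" using eq by (simp add: edge_jump_def)
      then show ?thesis using \<open>\<epsilon> a = r a\<close> \<open>\<epsilon> b = r b\<close> \<tau>' 3 e(6) by (simp add: S_def)
    qed (use \<tau>S in simp)
  qed
  then have on_triangles: "\<epsilon> v = r v" if "\<tau> \<in> K" "aff_dim \<tau> = 2" "v \<in> verts \<tau>" for \<tau> v
    using that by (auto simp: S_def)
  have "\<epsilon> v = r v" for v
  proof (cases "{v} \<in> K")
    case True
    obtain \<tau> where "\<tau> \<in> K" "aff_dim \<tau> = 2" "v \<in> verts \<tau>" using vertex_in_triangle[OF True] .
    then show ?thesis by (rule on_triangles)
  next
    case False
    then show ?thesis using \<epsilon> by (simp add: C0_def r_def restrict_to_vertices_def)
  qed
  then have "\<epsilon> = r" by auto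
  then show thesis using that q(1) by (simp add: r_def)
qed

section \<open>Simple integrability of the triangulation\<close>

lemma subcomplex_X0: "subcomplex (X0cells K P)"
  unfolding subcomplex_def
proof (intro conjI ballI impI)
  show "X0cells K P \<subseteq> X" by (simp add: X0cells_def)
  fix c c' assume c: "c \<in> X0cells K P" "c' \<in> X" "cell_le c' c"
  then obtain v where "interior_vertex K P v" "cell_le c (star_cell P {v})"
    by (auto simp: X0cells_def closed_star_def)
  moreover from this(2) have "cell_le c' (star_cell P {v})" using c(3) by (auto simp: cell_le_def)
  moreover have "c' \<in> Ycells K P" using c(2) by (simp add: Xcells_def)
  ultimately show "c' \<in> X0cells K P" using c(2) unfolding X0cells_def closed_star_def by blast
qed

text \<open>
  A cell in \<open>v\<^sup>*\<close> that is not a cell of \<open>X\<close> has the form \<open>[v,Q]\<close>, and no proper face \<open>Q\<close> of \<open>P\<close> contains an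
  interior vertex.
\<close>

lemma boundary_star_subset:
  assumes v: "interior_vertex K P v" shows "boundary_star K P v \<subseteq> X"
proof
  fix c assume "c \<in> boundary_star K P v"
  then obtain \<sigma> Q where c: "c = (\<sigma>, Q)" "(\<sigma>, Q) \<in> Ycells K P" "v \<in> \<sigma>" "(\<sigma>, Q) \<noteq> ({v}, P)"
    by (cases c) (auto simp: boundary_star_def closed_star_def cell_le_def star_cell_def)
  then have \<sigma>: "\<sigma> \<in> K" "\<sigma> \<subseteq> Q" "Q face_of P" by (auto simp: Ycells_def)
  have "v \<notin> frontier P" using v by (simp add: interior_vertex_def interior_simplex_def)
  then have "Q = P" using proper_face_frontier[OF \<sigma>(3)] c(3) \<sigma>(2) by blast
  then have "\<sigma> \<noteq> {v}" using c(4) by simp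
  then have "aff_dim \<sigma> \<noteq> 0" using c(3) by (auto simp: aff_dim_eq_0)
  moreover have "\<not> aff_dim \<sigma> < 0" using c(3) aff_dim_negative_iff[of \<sigma>] by blast
  ultimately have "aff_dim \<sigma> \<ge> 1" by linarith
  then show "c \<in> X" using c(1,2) by (simp add: Xcells_def)
qed

lemma boundary_star_subset_X0:
  "interior_vertex K P v \<Longrightarrow> boundary_star K P v \<subseteq> X0cells K P"
  using boundary_star_subset[of v] unfolding X0cells_def boundary_star_def by blast

lemma subcomplex_boundary_star:
  assumes v: "interior_vertex K P v" shows "subcomplex (boundary_star K P v)"
  unfolding subcomplex_def
proof (intro conjI ballI impI)
  show "boundary_star K P v \<subseteq> X" by (rule boundary_star_subset[OF v])
  fix c c' assume c: "c \<in> boundary_star K P v" "c' \<in> X" "cell_le c' c"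
  have "cell_le c (star_cell P {v})" using c(1) by (simp add: boundary_star_def closed_star_def)
  then have "cell_le c' (star_cell P {v})" using c(3) by (auto simp: cell_le_def)
  moreover have "star_cell P {v} \<notin> X" by (simp add: Xcells_def star_cell_def)
  moreover have "c' \<in> Ycells K P" using c(2) by (simp add: Xcells_def)
  ultimately show "c' \<in> boundary_star K P v" using c(2) by (auto simp: boundary_star_def closed_star_def)
qed

text \<open>
  The function \<open>\<chi>\<^sub>v\<close> vanishes at both apices and takes the values \<open>0\<close> and \<open>1\<close> at the endpoints, so the
  change of its gradient reduces to the parity.
\<close>

lemma edge_hessian_chi:
  assumes e: "interior_edge e" and v: "{v} \<in> K" "v \<in> e"
  shows "edge_hessian (chi v) e = edge_wave e"
proof -
  obtain a b c1 c2 \<tau>1 \<tau>2 where h: "hinge e a b c1 c2 \<tau>1 \<tau>2"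
    and iff: "\<And>\<epsilon>. edge_hessian \<epsilon> e = edge_wave e \<longleftrightarrow>
      edge_jump (red2 c1) (red2 c2) (\<epsilon> a) (\<epsilon> b) (\<epsilon> c1) (\<epsilon> c2) = edge_parity (red2 c1) (red2 c2)"
    using edge_equation[OF e] by metis
  note e = hingeD[OF h]
  have "v \<in> verts e" using subset_imp_face_of[of "{v}" e] v e(1) by (simp add: verts_def face_of_singleton)
  then have "v = a \<or> v = b" using e(2) by simp
  then show ?thesis unfolding iff using e(3,8,9) by (auto simp: chi_def edge_jump_def)
qed

text \<open>
  The Hessian of any quadratic function restricts to a uniform wave: on the edges dual to those
  through an interior vertex \<open>v\<close> it equals the canonical wave, and so does the Hessian of \<open>\<chi>\<^sub>v\<close>.
\<close>

lemma simply_integrable: "simply_integrable K P"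
proof -
  have "quadratic_function (\<lambda>p. p $ 1 * p $ 2)"
    unfolding quadratic_function_def by (intro exI[of _ 0]) simp
  then obtain q where q: "quadratic_function q" by blast
  define \<epsilon> where "\<epsilon> = restrict_to_vertices K q"
  define \<rho> where "\<rho> = wave_class (X0cells K P) (edge_hessian \<epsilon>)"
  have sol: "edge_hessian \<epsilon> e = edge_wave e" if "interior_edge e" for e
    using quadratic_is_solution[OF q] that unfolding hessian_eq_rho_tilde_iff \<epsilon>_def by blast
  have "restrict_coh (X0cells K P) W1 1 (hessian K P \<epsilon>) = \<rho>"
    unfolding hessian_eq \<rho>_def
    by (rule restrict_coh_wave_class[OF subcomplex_X0 subcomplex_X _ wave_values_edge_hessian])
      (simp add: X0cells_def)
  moreover have "uniform_wave K P \<rho>"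
    unfolding uniform_wave_def
  proof (intro conjI allI impI)
    show "\<rho> \<in> cohomology (X0cells K P) W1 1"
      unfolding \<rho>_def by (rule wave_class_in_cohomology[OF subcomplex_X0 wave_values_edge_hessian])
    fix v assume v: "interior_vertex K P v"
    let ?S = "boundary_star K P v"
    have "restrict_coh ?S W1 1 \<rho> = wave_class ?S (edge_hessian \<epsilon>)"
      unfolding \<rho>_def
      by (rule restrict_coh_wave_class[OF subcomplex_boundary_star[OF v] subcomplex_X0
            boundary_star_subset_X0[OF v] wave_values_edge_hessian])
    also have "\<dots> = wave_class ?S (edge_hessian (chi v))"
      unfolding wave_class_eq_iff[OF boundary_star_subset[OF v] wave_values_edge_hessian]
    proof (intro allI impI)
      fix e assume e: "interior_edge e \<and> (e, P) \<in> ?S"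
      then have "v \<in> e" by (auto simp: boundary_star_def closed_star_def cell_le_def star_cell_def)
      moreover have "{v} \<in> K" using v by (simp add: interior_vertex_def)
      ultimately show "edge_hessian \<epsilon> e = edge_hessian (chi v) e"
        using e sol edge_hessian_chi by simp
    qed
    also have "\<dots> = restrict_coh ?S W1 1 (hessian K P (chi v))"
      unfolding hessian_eq
      by (rule restrict_coh_wave_class[symmetric, OF subcomplex_boundary_star[OF v] subcomplex_X
            boundary_star_subset[OF v] wave_values_edge_hessian])
    finally show "restrict_coh ?S W1 1 \<rho> = restrict_coh ?S W1 1 (hessian K P (chi v))" .
  qed
  moreover have "\<epsilon> \<in> C0 K" unfolding \<epsilon>_def by (rule restrict_to_vertices_in_C0)
  ultimately show ?thesis unfolding simply_integrable_def rho_uniform_def by blast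
qed

end

theorem theorem5p12:
  fixes P :: "(real ^ 2) set" and K :: "(real ^ 2) set set"
  assumes "smooth_lattice_polygon P"
    and "primitive_triangulation K P"
  shows "{\<epsilon> \<in> C0 K. hessian K P \<epsilon> = rho_tilde K P}
           = {restrict_to_vertices K q | q. quadratic_function q}
         \<and> simply_integrable K P"
proof -
  interpret primitively_triangulated_polygon P K
    using assms by unfold_locales (simp_all add: smooth_lattice_polygon_def)
  have "{\<epsilon> \<in> C0 K. hessian K P \<epsilon> = rho_tilde K P} = {restrict_to_vertices K q | q. quadratic_function q}"
  proof (intro equalityI subsetI)
    fix \<epsilon> assume "\<epsilon> \<in> {\<epsilon> \<in> C0 K. hessian K P \<epsilon> = rho_tilde K P}"
    then obtain q where "quadratic_function q" "\<epsilon> = restrict_to_vertices K q"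
      using solution_is_quadratic by blast
    then show "\<epsilon> \<in> {restrict_to_vertices K q | q. quadratic_function q}" by blast
  next
    fix \<epsilon> assume "\<epsilon> \<in> {restrict_to_vertices K q | q. quadratic_function q}"
    then show "\<epsilon> \<in> {\<epsilon> \<in> C0 K. hessian K P \<epsilon> = rho_tilde K P}"
      using quadratic_is_solution restrict_to_vertices_in_C0 by blast
  qed
  then show ?thesis using simply_integrable by blast
qed

end
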